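(* Let $\mu$ be a Borel probability measure on $\mathbb{R}$ and let $h_\mu(z)=F_\mu(z)-z$, $z\in\mathbb{C}^+$. Assume that for every $x\in\mathbb{R}\cup\{\infty\}$, either the nontangential limit of $h_\mu$ at $x$ does not exist, or it exists and belongs to $\mathbb{C}^+$. Then for every Borel probability measure $\nu$ on $\mathbb{R}$ which is not a point mass, $\mu\boxplus\nu$ is absolutely continuous with respect to Lebesgue measure and its density is strictly positive and real-analytic on all of $\mathbb{R}$.
   Context: $\mathbb{C}^\pm=\{z:\pm\operatorname{Im}z>0\}$. For a Borel probability measure $\mu$ on $\mathbb{R}$, $G_\mu(z)=\int(z-t)^{-1}d\mu(t)$ and $F_\mu=1/G_\mu:\mathbb{C}^+\to\mathbb{C}^+$. $\mu\boxplus\nu$ denotes the free additive convolution (the unique probability measure whose Voiculescu transform $\phi(z)=F^{-1}(z)-z$, defined near $\infty$ in a cone $\{|z|>M,\operatorname{Im}z>\alpha|\operatorname{Re}z|\}$, equals $\phi_\mu+\phi_\nu$). Nontangential limit at $x\in\mathbb{R}$: limit as $z\to x$ within every cone $\{z\in\mathbb{C}^+:|\operatorname{Re}(z-x)|<c\operatorname{Im}z\}$, $c>0$; at $\infty$: as $|z|\to\infty$ within every cone $\{z\in\mathbb{C}^+:|\operatorname{Re}z|<c\operatorname{Im}z\}$. *)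

theory Defs
  imports "HOL-Probability.Probability"
begin

definition borel_prob :: "real measure \<Rightarrow> bool" where
  "borel_prob m \<longleftrightarrow> prob_space m \<and> sets m = sets borel"

definition cauchy_G :: "real measure \<Rightarrow> complex \<Rightarrow> complex" where
  "cauchy_G m z = (\<integral>t. 1 / (z - complex_of_real t) \<partial>m)"

definition recip_F :: "real measure \<Rightarrow> complex \<Rightarrow> complex" where
  "recip_F m z = 1 / cauchy_G m z"

definition h_fun :: "real measure \<Rightarrow> complex \<Rightarrow> complex" where
  "h_fun m z = recip_F m z - z"

definition inf_cone :: "real \<Rightarrow> real \<Rightarrow> complex set" where
  "inf_cone \<alpha> M = {z. cmod z > M \<and> Im z > \<alpha> * \<bar>Re z\<bar>}"

definition voiculescu_on :: "real measure \<Rightarrow> real \<Rightarrow> real \<Rightarrow> (complex \<Rightarrow> complex) \<Rightarrow> bool" where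
  "voiculescu_on m \<alpha> M \<phi> \<longleftrightarrow>
     (\<exists>\<alpha>' M'. \<alpha>' > 0 \<and> M' > 0 \<and> inj_on (recip_F m) (inf_cone \<alpha>' M') \<and>
        inf_cone \<alpha> M \<subseteq> recip_F m ` inf_cone \<alpha>' M' \<and>
        (\<forall>z\<in>inf_cone \<alpha> M. \<phi> z = inv_into (inf_cone \<alpha>' M') (recip_F m) z - z))"

definition free_conv :: "real measure \<Rightarrow> real measure \<Rightarrow> real measure \<Rightarrow> bool" where
  "free_conv \<mu> \<nu> \<rho> \<longleftrightarrow> borel_prob \<rho> \<and>
     (\<exists>\<alpha> M \<phi>1 \<phi>2 \<phi>3. \<alpha> > 0 \<and> M > 0 \<and>
        voiculescu_on \<mu> \<alpha> M \<phi>1 \<and> voiculescu_on \<nu> \<alpha> M \<phi>2 \<and> voiculescu_on \<rho> \<alpha> M \<phi>3 \<and>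
        (\<forall>z\<in>inf_cone \<alpha> M. \<phi>3 z = \<phi>1 z + \<phi>2 z))"

definition nt_cone :: "real \<Rightarrow> real \<Rightarrow> complex set" where
  "nt_cone x c = {z. Im z > 0 \<and> \<bar>Re z - x\<bar> < c * Im z}"

definition nt_cone_inf :: "real \<Rightarrow> complex set" where
  "nt_cone_inf c = {z. Im z > 0 \<and> \<bar>Re z\<bar> < c * Im z}"

definition nt_lim :: "(complex \<Rightarrow> complex) \<Rightarrow> real \<Rightarrow> complex \<Rightarrow> bool" where
  "nt_lim f x L \<longleftrightarrow> (\<forall>c>0. (f \<longlongrightarrow> L) (at (complex_of_real x) within nt_cone x c))"

definition nt_lim_infty_val :: "(complex \<Rightarrow> complex) \<Rightarrow> real \<Rightarrow> bool" where
  "nt_lim_infty_val f x \<longleftrightarrow> (\<forall>c>0. filterlim f at_infinity (at (complex_of_real x) within nt_cone x c))"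

definition nt_lim_at_inf :: "(complex \<Rightarrow> complex) \<Rightarrow> complex \<Rightarrow> bool" where
  "nt_lim_at_inf f L \<longleftrightarrow> (\<forall>c>0. (f \<longlongrightarrow> L) (inf at_infinity (principal (nt_cone_inf c))))"

definition nt_lim_at_inf_infty_val :: "(complex \<Rightarrow> complex) \<Rightarrow> bool" where
  "nt_lim_at_inf_infty_val f \<longleftrightarrow> (\<forall>c>0. filterlim f at_infinity (inf at_infinity (principal (nt_cone_inf c))))"

definition real_analytic_on :: "real set \<Rightarrow> (real \<Rightarrow> real) \<Rightarrow> bool" where
  "real_analytic_on S f \<longleftrightarrow> (\<forall>x\<in>S. \<exists>r>0. \<exists>a::nat \<Rightarrow> real.
      \<forall>y. \<bar>y - x\<bar> < r \<longrightarrow> (\<lambda>n. a n * (y - x) ^ n) sums f y)"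

end

theory Submission
  imports Defs "HOL-Complex_Analysis.Complex_Analysis"
begin

text \<open>
  For \<open>z\<close> in the closed upper half-plane, the subordination point \<open>\<omega> z\<close> is a fixed point in the
  open half-plane of \<open>w \<mapsto> z + h\<^sub>\<nu> (z + h\<^sub>\<mu> w)\<close>. If such fixed points, for bounded \<open>z\<close>, escaped to
  a boundary point \<open>a\<close> of the half-plane (possibly \<open>\<infinity>\<close>), the Schwarz--Pick inequality for
  \<open>h\<^sub>\<nu>\<close> would show that \<open>h\<^sub>\<mu>\<close> tends to the boundary along them at a comparable rate, and by the
  Julia--Caratheodory argument \<open>h\<^sub>\<mu>\<close> would have a real or infinite nontangential limit at \<open>a\<close>,
  which is excluded. So the set of \<open>z\<close> possessing a fixed point is closed. It is also open,
  because the same exclusion makes \<open>h\<^sub>\<mu>\<close> a strict hyperbolic contraction, so the derivative at a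
  fixed point has modulus less than one; and it is nonempty by the definition of the free
  convolution. Hence \<open>\<omega>\<close> exists on the whole closed half-plane, extends analytically across the
  real line and takes values in the open half-plane. By the identity theorem
  \<open>G\<^sub>\<rho> = G\<^sub>\<mu> \<circ> \<omega>\<close>, and Stieltjes inversion gives the density \<open>- Im G\<^sub>\<mu> (\<omega> x) / \<pi>\<close>.
\<close>

section \<open>Schwarz--Pick inequality in the upper half-plane\<close>

abbreviation uhp :: "complex set" where
  "uhp \<equiv> {z. 0 < Im z}"

text \<open>This is \<open>4 cosh\<^sup>2 (d/2)\<close> for the hyperbolic distance \<open>d\<close> of the upper half-plane.\<close>

definition pick_dist :: "complex \<Rightarrow> complex \<Rightarrow> real" where
  "pick_dist w v = (cmod (w - cnj v))\<^sup>2 / (Im w * Im v)"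

text \<open>The Moebius map of the half-plane onto the unit disc that sends \<open>p\<close> to 0.
  For \<open>p = \<i>\<close> it is the Cayley transform, under which the boundary point infinity
  becomes 1.\<close>

definition pick_map :: "complex \<Rightarrow> complex \<Rightarrow> complex" where
  "pick_map p w = (w - p) / (w - cnj p)"

definition pick_inv :: "complex \<Rightarrow> complex \<Rightarrow> complex" where
  "pick_inv p \<zeta> = (p - \<zeta> * cnj p) / (1 - \<zeta>)"

lemma cmod_diff_cnj_power2: "(cmod (w - cnj v))\<^sup>2 = (cmod (w - v))\<^sup>2 + 4 * (Im w * Im v)"
  unfolding cmod_power2 by (simp add: power2_eq_square algebra_simps)

lemma uhp_diff_cnj_nonzero: "0 < Im w \<Longrightarrow> 0 < Im v \<Longrightarrow> w - cnj v \<noteq> 0"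
  by (auto simp: complex_eq_iff)

lemma Im_le_cmod_diff_cnj: "0 < Im w \<Longrightarrow> 0 < Im v \<Longrightarrow> Im v \<le> cmod (w - cnj v)"
  using abs_Im_le_cmod[of "w - cnj v"] by simp

lemma pick_dist_ge_4: "0 < Im w \<Longrightarrow> 0 < Im v \<Longrightarrow> 4 \<le> pick_dist w v"
  by (simp add: pick_dist_def cmod_diff_cnj_power2 field_simps)

text \<open>In terms of the hyperbolic distance d this is tanh^2 (d/2) = 1 - 1 / cosh^2 (d/2). Hence
  \<open>pick_dist\<close> and the modulus in the disc order pairs of points in the same
  way.\<close>

lemma norm_pick_map_power2:
  assumes "0 < Im w" "0 < Im p"
  shows "(cmod (pick_map p w))\<^sup>2 = 1 - 4 / pick_dist w p"
proof -
  have "(cmod (w - p))\<^sup>2 = (cmod (w - cnj p))\<^sup>2 - 4 * (Im w * Im p)"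
    by (simp add: cmod_diff_cnj_power2)
  then show ?thesis
    using assms uhp_diff_cnj_nonzero[OF assms]
    by (simp add: pick_map_def pick_dist_def norm_divide power_divide field_simps)
qed

lemma pick_dist_le_iff:
  assumes "0 < Im w" "0 < Im p" "0 < Im w'" "0 < Im p'"
  shows "pick_dist w p \<le> pick_dist w' p' \<longleftrightarrow> cmod (pick_map p w) \<le> cmod (pick_map p' w')"
proof -
  have D: "4 \<le> pick_dist w p" "4 \<le> pick_dist w' p'"
    using assms pick_dist_ge_4 by auto
  have "cmod (pick_map p w) \<le> cmod (pick_map p' w') \<longleftrightarrow>
        (cmod (pick_map p w))\<^sup>2 \<le> (cmod (pick_map p' w'))\<^sup>2"
    by (simp add: abs_le_square_iff[symmetric])
  also have "\<dots> \<longleftrightarrow> pick_dist w p \<le> pick_dist w' p'"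
    using D by (simp add: norm_pick_map_power2 assms field_simps)
  finally show ?thesis by simp
qed

lemma norm_pick_map_less_1: "0 < Im w \<Longrightarrow> 0 < Im p \<Longrightarrow> cmod (pick_map p w) < 1"
  using norm_pick_map_power2[of w p] pick_dist_ge_4[of w p] abs_square_less_1[of "cmod (pick_map p w)"]
  by simp

lemma Im_pick_inv:
  assumes "cmod \<zeta> < 1" "0 < Im p"
  shows "0 < Im (pick_inv p \<zeta>)"
proof -
  have n: "1 - \<zeta> \<noteq> 0" using assms by auto
  have "Im (pick_inv p \<zeta>) = Im p * (1 - (cmod \<zeta>)\<^sup>2) / (cmod (1 - \<zeta>))\<^sup>2"
    unfolding pick_inv_def Im_divide cmod_power2
    by (simp add: power2_eq_square algebra_simps)
  moreover have "(cmod \<zeta>)\<^sup>2 < 1" using assms by (simp add: abs_square_less_1)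
  ultimately show ?thesis using assms n by simp
qed

lemma pick_inv_pick_map:
  assumes "0 < Im w" "0 < Im p"
  shows "pick_inv p (pick_map p w) = w"
proof -
  have n: "w - cnj p \<noteq> 0" "p - cnj p \<noteq> 0" using assms uhp_diff_cnj_nonzero by blast+
  have 1: "1 - pick_map p w = (p - cnj p) / (w - cnj p)"
    using n by (simp add: pick_map_def field_simps)
  have 2: "p - pick_map p w * cnj p = w * (p - cnj p) / (w - cnj p)"
    using n by (simp add: pick_map_def field_simps)
  show ?thesis unfolding pick_inv_def 1 2 using n by simp
qed

text \<open>Conjugation by \<open>pick_map p\<close> and \<open>pick_map (k p)\<close> moves both
  base points to 0, so the Schwarz lemma applies to \<open>g\<close>. The second claim is its
  equality case: equality at one other point, or a derivative of modulus at least 1 at a fixed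
  point, makes \<open>g\<close> a rotation.\<close>

lemma schwarz_pick_aux:
  assumes hol: "k holomorphic_on uhp" and k: "\<And>w. 0 < Im w \<Longrightarrow> 0 < Im (k w)" and p: "0 < Im p"
  shows "0 < Im w \<Longrightarrow> cmod (pick_map (k p) (k w)) \<le> cmod (pick_map p w)"
    and "(\<exists>v. 0 < Im v \<and> v \<noteq> p \<and> cmod (pick_map (k p) (k v)) = cmod (pick_map p v)) \<or>
         k p = p \<and> 1 \<le> cmod (deriv k p) \<Longrightarrow> 0 < Im w \<Longrightarrow>
         cmod (pick_map (k p) (k w)) = cmod (pick_map p w)"
proof -
  define g where "g = (\<lambda>\<zeta>. pick_map (k p) (k (pick_inv p \<zeta>)))"
  have gw: "g (pick_map p w) = pick_map (k p) (k w)" if "0 < Im w" for w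
    using that p by (simp add: g_def pick_inv_pick_map)
  have hol_inv: "pick_inv p holomorphic_on ball 0 1"
    unfolding pick_inv_def by (intro holomorphic_intros) auto
  have hol_ki: "(\<lambda>\<zeta>. k (pick_inv p \<zeta>)) holomorphic_on ball 0 1"
    by (rule holomorphic_on_compose_gen[OF hol_inv hol, unfolded o_def]) (use Im_pick_inv p in auto)
  have holg: "g holomorphic_on ball 0 1"
    unfolding g_def pick_map_def
    by (intro holomorphic_intros hol_ki)
       (use uhp_diff_cnj_nonzero k p Im_pick_inv in auto)
  have g0: "g 0 = 0" by (simp add: g_def pick_inv_def pick_map_def)
  have g1: "cmod (g z) < 1" if "cmod z < 1" for z
    using that p k by (auto simp: g_def intro!: norm_pick_map_less_1 Im_pick_inv)
  note S = Schwarz_Lemma[OF holg g0 g1]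
  show "cmod (pick_map (k p) (k w)) \<le> cmod (pick_map p w)" if w: "0 < Im w"
    using S(1)[of "pick_map p w"] norm_pick_map_less_1[OF w p] gw[OF w] by simp
  show "cmod (pick_map (k p) (k w)) = cmod (pick_map p w)"
    if *: "(\<exists>v. 0 < Im v \<and> v \<noteq> p \<and> cmod (pick_map (k p) (k v)) = cmod (pick_map p v)) \<or>
         k p = p \<and> 1 \<le> cmod (deriv k p)" and w: "0 < Im w"
  proof -
    have "(\<exists>z. cmod z < 1 \<and> z \<noteq> 0 \<and> cmod (g z) = cmod z) \<or> cmod (deriv g 0) = 1"
      using *
    proof
      assume "\<exists>v. 0 < Im v \<and> v \<noteq> p \<and> cmod (pick_map (k p) (k v)) = cmod (pick_map p v)"
      then obtain v where v: "0 < Im v" "v \<noteq> p" "cmod (pick_map (k p) (k v)) = cmod (pick_map p v)"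
        by blast
      then have "cmod (pick_map p v) < 1 \<and> pick_map p v \<noteq> 0 \<and> cmod (g (pick_map p v)) = cmod (pick_map p v)"
        using gw p norm_pick_map_less_1 uhp_diff_cnj_nonzero[of v p] by (auto simp: pick_map_def)
      then show ?thesis by blast
    next
      assume kp: "k p = p \<and> 1 \<le> cmod (deriv k p)"
      have n: "p - cnj p \<noteq> 0" using p uhp_diff_cnj_nonzero by blast
      have i0: "pick_inv p 0 = p" by (simp add: pick_inv_def)
      have d1: "(pick_inv p has_field_derivative (p - cnj p)) (at 0)"
        unfolding pick_inv_def by (auto intro!: derivative_eq_intros)
      have d2: "(k has_field_derivative deriv k p) (at (pick_inv p 0))"
        unfolding i0 using hol p by (simp add: holomorphic_derivI open_halfspace_Im_gt)
      have d3: "(pick_map p has_field_derivative 1 / (p - cnj p)) (at (k (pick_inv p 0)))"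
        unfolding pick_map_def i0 using n kp
        by (auto intro!: derivative_eq_intros)
      \<comment> \<open>Since \<open>k p = p\<close>, the derivatives of the two conjugating maps
        are reciprocal, so \<open>g\<close> has at 0 the derivative of \<open>k\<close> at
        \<open>p\<close>. The Schwarz lemma bounds its modulus by 1, which makes it exactly
        1.\<close>
      have "(g has_field_derivative 1 / (p - cnj p) * (deriv k p * (p - cnj p))) (at 0)"
        using DERIV_chain2[OF d3 DERIV_chain2[OF d2 d1]] kp by (simp add: g_def)
      then have "deriv g 0 = deriv k p" using n by (auto dest!: DERIV_imp_deriv)
      then show ?thesis using kp S(2)[of 0] by auto
    qed
    from S(3)[OF _ _ this, of 0] obtain \<alpha> where \<alpha>: "\<And>z. cmod z < 1 \<Longrightarrow> g z = \<alpha> * z" "cmod \<alpha> = 1"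
      by auto
    show ?thesis
      using \<alpha>(1)[of "pick_map p w"] norm_pick_map_less_1[OF w p] gw[OF w] \<alpha>(2) by (simp add: norm_mult)
  qed
qed

lemma schwarz_pick:
  assumes "k holomorphic_on uhp" "\<And>w. 0 < Im w \<Longrightarrow> 0 < Im (k w)" "0 < Im p" "0 < Im w"
  shows "pick_dist (k w) (k p) \<le> pick_dist w p"
  using schwarz_pick_aux(1)[OF assms(1-4)] assms by (simp add: pick_dist_le_iff)

lemma schwarz_pick_rigid:
  assumes "k holomorphic_on uhp" "\<And>w. 0 < Im w \<Longrightarrow> 0 < Im (k w)" "0 < Im p"
    and "0 < Im v" "v \<noteq> p" "pick_dist v p \<le> pick_dist (k v) (k p)" "0 < Im w"
  shows "pick_dist w p \<le> pick_dist (k w) (k p)"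
proof -
  have "cmod (pick_map p v) = cmod (pick_map (k p) (k v))"
    using assms schwarz_pick_aux(1)[OF assms(1-4)] by (simp add: pick_dist_le_iff)
  then show ?thesis
    using schwarz_pick_aux(2)[OF assms(1-3), of w] assms by (force simp: pick_dist_le_iff)
qed

text \<open>Otherwise the equality case would make \<open>k\<close> preserve every distance to the
  fixed point, and one strictly contracted distance rules this out.\<close>

lemma norm_deriv_fixpoint_less_1:
  assumes "k holomorphic_on uhp" "\<And>w. 0 < Im w \<Longrightarrow> 0 < Im (k w)" "0 < Im p" "k p = p"
    and "0 < Im v" "pick_dist (k v) (k p) < pick_dist v p"
  shows "cmod (deriv k p) < 1"
proof (rule ccontr)
  assume "\<not> cmod (deriv k p) < 1"
  then have "cmod (pick_map (k p) (k v)) = cmod (pick_map p v)"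
    using schwarz_pick_aux(2)[OF assms(1-3), of v] assms by auto
  then have "pick_dist v p \<le> pick_dist (k v) (k p)"
    using assms by (simp add: pick_dist_le_iff)
  with assms show False by simp
qed

text \<open>A translation keeps \<open>w - v\<close> and does not decrease the imaginary parts, and
  \<open>pick_dist\<close> is 4 plus the squared modulus of \<open>w - v\<close> divided by
  \<open>Im w * Im v\<close>.\<close>

lemma pick_dist_add_le:
  assumes "0 \<le> Im z" "0 < Im w" "0 < Im v"
  shows "pick_dist (z + w) (z + v) \<le> pick_dist w v"
proof -
  have "pick_dist w v = (cmod (w - v))\<^sup>2 / (Im w * Im v) + 4" if "0 < Im w" "0 < Im v" for w v
    using that by (simp add: pick_dist_def cmod_diff_cnj_power2 field_simps)
  moreover have "(cmod (w - v))\<^sup>2 / (Im (z + w) * Im (z + v)) \<le> (cmod (w - v))\<^sup>2 / (Im w * Im v)"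
    using assms by (intro divide_left_mono mult_mono mult_pos_pos) auto
  ultimately show ?thesis using assms by simp
qed

text \<open>\<open>pick_dist\<close> grows like the exponential of the distance, so a change of base
  point costs only a constant factor. The additive error of the triangle inequality is absorbed by
  \<open>Im p \<le> cmod (w - cnj p)\<close>.\<close>

lemma pick_dist_basepoint_le:
  assumes "0 < Im p" "0 < Im q" "0 < Im w"
  shows "pick_dist w q \<le> (1 + cmod (p - q) / Im p)\<^sup>2 * Im p / Im q * pick_dist w p"
proof -
  have "cmod (w - cnj q) \<le> cmod (w - cnj p) + cmod (p - q)"
  proof -
    have "cmod (w - cnj q) \<le> cmod (w - cnj p) + cmod (cnj (p - q))"
      using norm_triangle_ineq[of "w - cnj p" "cnj (p - q)"] by (simp add: algebra_simps)
    then show ?thesis by (simp only: complex_mod_cnj)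
  qed
  also have "cmod (p - q) = cmod (p - q) / Im p * Im p" using assms by simp
  also have "\<dots> \<le> cmod (p - q) / Im p * cmod (w - cnj p)"
    using assms Im_le_cmod_diff_cnj by (intro mult_left_mono) auto
  finally have "cmod (w - cnj q) \<le> (1 + cmod (p - q) / Im p) * cmod (w - cnj p)"
    by (simp add: algebra_simps)
  then have "(cmod (w - cnj q))\<^sup>2 \<le> ((1 + cmod (p - q) / Im p) * cmod (w - cnj p))\<^sup>2"
    by (intro power_mono) auto
  then have "(cmod (w - cnj q))\<^sup>2 / (Im w * Im q) \<le>
      (1 + cmod (p - q) / Im p)\<^sup>2 * (cmod (w - cnj p))\<^sup>2 / (Im w * Im q)"
    using assms by (intro divide_right_mono) (auto simp: power_mult_distrib)
  also have "\<dots> = (1 + cmod (p - q) / Im p)\<^sup>2 * Im p / Im q * pick_dist w p"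
    using assms by (simp add: pick_dist_def)
  finally show ?thesis by (simp add: pick_dist_def)
qed

text \<open>Unlike in \<open>pick_dist_add_le\<close>, only one of the two points is translated, so
  a factor depending on the bound \<open>R\<close> appears.\<close>

lemma pick_dist_translate_le:
  assumes "0 \<le> Im z" "0 < Im w" "cmod z \<le> R"
  shows "pick_dist (z + w) \<i> \<le> (1 + R)\<^sup>2 * pick_dist w \<i>"
proof -
  have R: "0 \<le> R" using assms(3) norm_ge_zero order_trans by blast
  have "cmod (z + w + \<i>) \<le> cmod (w + \<i>) + R * 1"
    using norm_triangle_ineq[of z "w + \<i>"] assms by (simp add: algebra_simps)
  also have "R * 1 \<le> R * cmod (w + \<i>)"
    using Im_le_cmod_diff_cnj[of w \<i>] assms R by (intro mult_left_mono) auto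
  finally have "cmod (z + w + \<i>) \<le> (1 + R) * cmod (w + \<i>)" by (simp add: algebra_simps)
  then have "(cmod (z + w + \<i>))\<^sup>2 \<le> (1 + R)\<^sup>2 * (cmod (w + \<i>))\<^sup>2"
    unfolding power_mult_distrib[symmetric] by (intro power_mono) auto
  then have "(cmod (z + w + \<i>))\<^sup>2 / Im (z + w) \<le> (1 + R)\<^sup>2 * (cmod (w + \<i>))\<^sup>2 / Im w"
    using assms by (intro frac_le) auto
  then show ?thesis by (simp add: pick_dist_def)
qed

text \<open>Schwarz--Pick measures from \<open>k \<i>\<close>; returning to the base point
  \<open>\<i>\<close> costs the factor \<open>C\<close>. With one fixed base point such estimates
  can be chained.\<close>

lemma pick_dist_self_map_le:
  assumes "k holomorphic_on uhp" "\<And>w. 0 < Im w \<Longrightarrow> 0 < Im (k w)"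
  obtains C where "C \<ge> 0" "\<And>w. 0 < Im w \<Longrightarrow> pick_dist (k w) \<i> \<le> C * pick_dist w \<i>"
proof -
  define C where "C = (1 + cmod (k \<i> - \<i>) / Im (k \<i>))\<^sup>2 * Im (k \<i>) / Im \<i>"
  have ki: "0 < Im (k \<i>)" using assms by simp
  have C0: "C \<ge> 0" using ki by (simp add: C_def)
  show thesis
  proof (rule that[OF C0])
    fix w assume w: "0 < Im w"
    have "pick_dist (k w) \<i> \<le> C * pick_dist (k w) (k \<i>)"
      unfolding C_def by (rule pick_dist_basepoint_le) (use assms w in auto)
    also have "\<dots> \<le> C * pick_dist w \<i>"
      using schwarz_pick[OF assms, of \<i> w] w C0 by (intro mult_left_mono) auto
    finally show "pick_dist (k w) \<i> \<le> C * pick_dist w \<i>" .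
  qed
qed

lemma compact_pick_ball: "compact {w. 0 < Im w \<and> pick_dist w \<i> \<le> B}"
proof (cases "B \<ge> 0")
  case True
  \<comment> \<open>Multiplying out by \<open>Im w\<close> gives closed conditions. A real
    \<open>w\<close> cannot satisfy them, because \<open>w + \<i>\<close> would vanish.\<close>
  have eq: "{w. 0 < Im w \<and> pick_dist w \<i> \<le> B} = {w. 0 \<le> Im w \<and> (cmod (w + \<i>))\<^sup>2 \<le> B * Im w}"
  proof (intro set_eqI iffI; clarsimp)
    fix w assume "0 \<le> Im w" "(cmod (w + \<i>))\<^sup>2 \<le> B * Im w"
    moreover have "w + \<i> \<noteq> 0" if "0 \<le> Im w" using that by (auto simp: complex_eq_iff)
    ultimately have "Im w \<noteq> 0" by auto
    with \<open>0 \<le> Im w\<close> \<open>(cmod (w + \<i>))\<^sup>2 \<le> B * Im w\<close> show "0 < Im w \<and> pick_dist w \<i> \<le> B"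
      by (simp add: pick_dist_def field_simps)
  qed (auto simp: pick_dist_def field_simps)
  have "closed {w. 0 \<le> Im w \<and> (cmod (w + \<i>))\<^sup>2 \<le> B * Im w}"
    by (intro closed_Collect_conj closed_Collect_le continuous_intros)
  moreover have "bounded {w. 0 \<le> Im w \<and> (cmod (w + \<i>))\<^sup>2 \<le> B * Im w}"
  proof (rule boundedI)
    fix w assume w: "w \<in> {w. 0 \<le> Im w \<and> (cmod (w + \<i>))\<^sup>2 \<le> B * Im w}"
    then have *: "Im w \<le> cmod (w + \<i>)"
      using abs_Im_le_cmod[of "w + \<i>"] by simp
    have "(cmod (w + \<i>))\<^sup>2 \<le> B * cmod (w + \<i>)"
      using w mult_left_mono[OF * True] by auto
    then have "cmod (w + \<i>) \<le> B"
      using True by (cases "cmod (w + \<i>) = 0") (auto simp: power2_eq_square mult_le_cancel_right)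
    then show "cmod w \<le> B + 1"
      using norm_triangle_ineq4[of "w + \<i>" \<i>] by simp
  qed
  ultimately show ?thesis unfolding eq using compact_eq_bounded_closed by blast
next
  case False
  then have "{w. 0 < Im w \<and> pick_dist w \<i> \<le> B} = {}"
    using pick_dist_ge_4[of _ \<i>] by fastforce
  then show ?thesis by (simp only: compact_empty)
qed

section \<open>Julia's lemma and nontangential limits\<close>

text \<open>The identity separates the factor \<open>pick_dist v \<i>\<close>, which blows up when
  \<open>v\<close> tends to the boundary, from a factor that stays continuous in the disc coordinate
  of \<open>v\<close> up to the unit circle. This makes the limit in Julia's lemma possible.\<close>

lemma pick_dist_eq_cayley:
  assumes "0 < Im w" "0 < Im v"
  shows "(cmod (1 - cnj (pick_map \<i> v) * pick_map \<i> w))\<^sup>2 * pick_dist w \<i> * pick_dist v \<i>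
         = 4 * pick_dist w v"
proof -
  have n: "w + \<i> \<noteq> 0" "v + \<i> \<noteq> 0" "cnj v - \<i> \<noteq> 0"
    using assms by (auto simp: complex_eq_iff)
  have frac: "1 - A / B * (C / D) = (B * D - A * C) / (B * D)" if "B \<noteq> 0" "D \<noteq> 0"
    for A B C D :: complex
    using that by (simp add: diff_divide_distrib)
  have "1 - cnj (pick_map \<i> v) * pick_map \<i> w
      = ((cnj v - \<i>) * (w + \<i>) - (cnj v + \<i>) * (w - \<i>)) / ((cnj v - \<i>) * (w + \<i>))"
    using frac[of "cnj v - \<i>" "w + \<i>" "cnj v + \<i>" "w - \<i>"] n by (simp add: pick_map_def)
  also have "\<dots> = - 2 * \<i> * (w - cnj v) / ((w + \<i>) * cnj (v + \<i>))"
    by (simp add: algebra_simps)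
  finally have "1 - cnj (pick_map \<i> v) * pick_map \<i> w = - 2 * \<i> * (w - cnj v) / ((w + \<i>) * cnj (v + \<i>))" .
  then have "cmod (1 - cnj (pick_map \<i> v) * pick_map \<i> w) = 2 * cmod (w - cnj v) / (cmod (w + \<i>) * cmod (v + \<i>))"
    by (simp only: norm_divide norm_mult complex_mod_cnj) simp
  then show ?thesis
    using assms n by (simp add: pick_dist_def power_divide power_mult_distrib)
qed

lemma cmod_one_minus_cnj_mult:
  assumes "cmod b = 1"
  shows "cmod (1 - cnj b * d) = cmod (b - d)"
proof -
  have "cnj b * b = 1" using assms complex_norm_square[of b] by (simp add: mult.commute)
  then have "1 - cnj b * d = cnj b * (b - d)" by (simp add: algebra_simps)
  then show ?thesis using assms by (simp add: norm_mult)
qed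

lemma norm_limit_pick_map_eq_1:
  assumes "\<And>n. 0 < Im (w n)" "(\<lambda>n. pick_map \<i> (w n)) \<longlonglongrightarrow> a"
    and "filterlim (\<lambda>n. pick_dist (w n) \<i>) at_top sequentially"
  shows "cmod a = 1"
proof -
  have "(\<lambda>n. 1 - 4 / pick_dist (w n) \<i>) \<longlonglongrightarrow> 1 - 0"
    by (intro tendsto_intros tendsto_divide_0[OF tendsto_const] filterlim_at_top_imp_at_infinity assms(3))
  moreover have "(\<lambda>n. 1 - 4 / pick_dist (w n) \<i>) = (\<lambda>n. (cmod (pick_map \<i> (w n)))\<^sup>2)"
    using assms(1) by (simp add: norm_pick_map_power2)
  moreover have "(\<lambda>n. (cmod (pick_map \<i> (w n)))\<^sup>2) \<longlonglongrightarrow> (cmod a)\<^sup>2"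
    by (intro tendsto_intros assms(2))
  ultimately have "(cmod a)\<^sup>2 = 1" by (simp add: LIMSEQ_unique)
  then show ?thesis using power2_eq_1_iff[of "cmod a"] norm_ge_zero[of a] by linarith
qed

text \<open>
  Julia's lemma: the hypothesis supplies points \<open>w\<^sub>n\<close> leaving every compact set while
  \<open>k w\<^sub>n\<close> leaves at a comparable rate; the conclusion is the limit, in disc coordinates,
  of the Schwarz--Pick inequality between \<open>w\<close> and \<open>w\<^sub>n\<close>.
\<close>

lemma julia:
  assumes hol: "k holomorphic_on uhp" and k: "\<And>w. 0 < Im w \<Longrightarrow> 0 < Im (k w)"
    and unbdd: "\<nexists>B. \<forall>w. 0 < Im w \<and> pick_dist w \<i> \<le> C * pick_dist (k w) \<i> \<longrightarrow> pick_dist w \<i> \<le> B"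
  obtains a b where "cmod a = 1" "cmod b = 1" "C > 0"
    "\<And>w. 0 < Im w \<Longrightarrow>
      (cmod (b - pick_map \<i> (k w)))\<^sup>2 \<le> C * ((cmod (a - pick_map \<i> w))\<^sup>2 * pick_dist w \<i>)"
proof -
  have "\<forall>n. \<exists>w. 0 < Im w \<and> pick_dist w \<i> \<le> C * pick_dist (k w) \<i> \<and> real n < pick_dist w \<i>"
    using unbdd by (metis not_le)
  then obtain w where w: "\<And>n. 0 < Im (w n)" "\<And>n. pick_dist (w n) \<i> \<le> C * pick_dist (k (w n)) \<i>"
      "\<And>n. real n < pick_dist (w n) \<i>"
    by metis
  have "0 < C * pick_dist (k (w 0)) \<i>" "0 < pick_dist (k (w 0)) \<i>"
    using w(1,2)[of 0] pick_dist_ge_4[of "w 0" \<i>] pick_dist_ge_4[of "k (w 0)" \<i>] k by force+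
  then have C: "C > 0" by (simp add: zero_less_mult_iff)
  \<comment> \<open>Both disc coordinates stay in the closed unit disc, so they converge along a
    common subsequence.\<close>
  have cpt: "compact (cball (0::complex) 1 \<times> cball (0::complex) 1)"
    by (intro compact_Times compact_cball)
  have mem: "\<forall>n. (pick_map \<i> (w n), pick_map \<i> (k (w n))) \<in> cball 0 1 \<times> cball 0 1"
    using norm_pick_map_less_1 w(1) k by (auto intro: less_imp_le)
  obtain ab r where "ab \<in> cball 0 1 \<times> cball 0 1" and r: "strict_mono r"
      "((\<lambda>n. (pick_map \<i> (w n), pick_map \<i> (k (w n)))) \<circ> r) \<longlonglongrightarrow> ab"
    by (rule seq_compactE[OF compact_imp_seq_compact[OF cpt] mem])
  define a b where "a = fst ab" and "b = snd ab"
  have la: "(\<lambda>n. pick_map \<i> (w (r n))) \<longlonglongrightarrow> a" and lb: "(\<lambda>n. pick_map \<i> (k (w (r n)))) \<longlonglongrightarrow> b"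
    using tendsto_fst[OF r(2)] tendsto_snd[OF r(2)] by (auto simp: a_def b_def o_def)
  have rn: "n \<le> r n" for n using r(1) by (rule strict_mono_imp_increasing)
  have wr: "real n \<le> pick_dist (w (r n)) \<i>" for n
    using w(3)[of "r n"] rn[of n] by linarith
  have l1: "filterlim (\<lambda>n. pick_dist (w (r n)) \<i>) at_top sequentially"
    by (rule filterlim_at_top_mono[OF filterlim_real_sequentially]) (use wr in auto)
  \<comment> \<open>Comparability with the constant \<open>C\<close> forces the images to leave
    every compact set as well; hence \<open>b\<close> also lies on the unit circle.\<close>
  have "filterlim (\<lambda>n. inverse C * real n) at_top sequentially"
    by (rule filterlim_tendsto_pos_mult_at_top[OF tendsto_const _ filterlim_real_sequentially]) (use C in auto)
  moreover have "\<forall>\<^sub>F n in sequentially. inverse C * real n \<le> pick_dist (k (w (r n))) \<i>"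
    using order_trans[OF wr w(2)] C by (simp add: field_simps)
  ultimately have l2: "filterlim (\<lambda>n. pick_dist (k (w (r n))) \<i>) at_top sequentially"
    by (rule filterlim_at_top_mono)
  have a: "cmod a = 1" by (rule norm_limit_pick_map_eq_1[OF _ la l1]) (rule w)
  have b: "cmod b = 1" by (rule norm_limit_pick_map_eq_1[OF _ lb l2]) (intro k w)
  show thesis
  proof (rule that[OF a b C])
    fix v assume v: "0 < Im v"
    let ?X = "\<lambda>n. (cmod (1 - cnj (pick_map \<i> (k (w (r n)))) * pick_map \<i> (k v)))\<^sup>2"
    let ?Y = "\<lambda>n. (cmod (1 - cnj (pick_map \<i> (w (r n))) * pick_map \<i> v))\<^sup>2"
    \<comment> \<open>Schwarz--Pick between \<open>v\<close> and \<open>w (r n)\<close> has a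
      diverging factor on each side. By the choice of the sequence the right one is at most
      \<open>C\<close> times the left one, so they cancel and both sides have limits.\<close>
    have "?X n * pick_dist (k v) \<i> \<le> C * (?Y n * pick_dist v \<i>)" for n
    proof -
      have p: "0 < pick_dist (k (w (r n))) \<i>"
        using pick_dist_ge_4[OF k[OF w(1)], of \<i> "r n"] by simp
      have "?X n * pick_dist (k v) \<i> * pick_dist (k (w (r n))) \<i> = 4 * pick_dist (k v) (k (w (r n)))"
        using pick_dist_eq_cayley[OF k[OF v] k[OF w(1)]] .
      also have "\<dots> \<le> 4 * pick_dist v (w (r n))"
        using schwarz_pick[OF hol k w(1) v] by simp
      also have "\<dots> = ?Y n * pick_dist v \<i> * pick_dist (w (r n)) \<i>"
        using pick_dist_eq_cayley[OF v w(1)] by simp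
      also have "\<dots> \<le> ?Y n * pick_dist v \<i> * (C * pick_dist (k (w (r n))) \<i>)"
        using pick_dist_ge_4[OF v, of \<i>] by (intro mult_left_mono w mult_nonneg_nonneg) auto
      finally have "(?X n * pick_dist (k v) \<i>) * pick_dist (k (w (r n))) \<i>
         \<le> (C * (?Y n * pick_dist v \<i>)) * pick_dist (k (w (r n))) \<i>" by (simp add: mult_ac)
      then show ?thesis using p by (simp only: mult_le_cancel_right_pos)
    qed
    then have "\<exists>N. \<forall>n\<ge>N. ?X n * pick_dist (k v) \<i> \<le> C * (?Y n * pick_dist v \<i>)" by blast
    moreover have "(\<lambda>n. ?X n * pick_dist (k v) \<i>) \<longlonglongrightarrow>
        (cmod (1 - cnj b * pick_map \<i> (k v)))\<^sup>2 * pick_dist (k v) \<i>"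
      by (intro tendsto_intros lb)
    moreover have "(\<lambda>n. C * (?Y n * pick_dist v \<i>)) \<longlonglongrightarrow>
        C * ((cmod (1 - cnj a * pick_map \<i> v))\<^sup>2 * pick_dist v \<i>)"
      by (intro tendsto_intros la)
    ultimately have "(cmod (b - pick_map \<i> (k v)))\<^sup>2 * pick_dist (k v) \<i>
        \<le> C * ((cmod (a - pick_map \<i> v))\<^sup>2 * pick_dist v \<i>)"
      unfolding cmod_one_minus_cnj_mult[OF a] cmod_one_minus_cnj_mult[OF b] by (intro LIMSEQ_le)
    \<comment> \<open>The factor \<open>pick_dist (k v) \<i>\<close> is weakened to 1, as only
      convergence of the disc coordinate to \<open>b\<close> is wanted.\<close>
    moreover have "(cmod (b - pick_map \<i> (k v)))\<^sup>2 * 1 \<le> (cmod (b - pick_map \<i> (k v)))\<^sup>2 * pick_dist (k v) \<i>"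
      using pick_dist_ge_4[OF k[OF v], of \<i>] by (intro mult_left_mono) auto
    ultimately show "(cmod (b - pick_map \<i> (k v)))\<^sup>2 \<le> C * ((cmod (a - pick_map \<i> v))\<^sup>2 * pick_dist v \<i>)"
      by linarith
  qed
qed

text \<open>The right-hand side of Julia's inequality for \<open>a = 1\<close>, the point at
  infinity. Its level sets are horocycles, and inside a cone it is of order
  \<open>1 / cmod w\<close>.\<close>

lemma cayley_boundary_infinity:
  assumes "0 < Im w"
  shows "(cmod (1 - pick_map \<i> w))\<^sup>2 * pick_dist w \<i> = 4 / Im w"
proof -
  have n: "w + \<i> \<noteq> 0" using assms by (auto simp: complex_eq_iff)
  have "1 - pick_map \<i> w = 2 * \<i> / (w + \<i>)" using n by (simp add: pick_map_def field_simps)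
  then show ?thesis using assms n by (simp add: pick_dist_def norm_divide norm_mult power_divide)
qed

text \<open>The same quantity for the boundary point \<open>x\<close>; inside a cone at
  \<open>x\<close> it is of order \<open>cmod (w - of_real x)\<close>.\<close>

lemma cayley_boundary_real:
  assumes "0 < Im w"
  shows "(cmod ((of_real x - \<i>) / (of_real x + \<i>) - pick_map \<i> w))\<^sup>2 * pick_dist w \<i>
     = 4 / (cmod (of_real x + \<i>))\<^sup>2 * ((cmod (w - of_real x))\<^sup>2 / Im w)"
proof -
  have n: "w + \<i> \<noteq> 0" "of_real x + \<i> \<noteq> 0" using assms by (auto simp: complex_eq_iff)
  have "(of_real x - \<i>) / (of_real x + \<i>) - pick_map \<i> w = - 2 * \<i> * (w - of_real x) / ((of_real x + \<i>) * (w + \<i>))"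
    using n by (simp add: pick_map_def field_simps)
  then have "cmod ((of_real x - \<i>) / (of_real x + \<i>) - pick_map \<i> w)
      = 2 * cmod (w - of_real x) / (cmod (of_real x + \<i>) * cmod (w + \<i>))"
    by (simp only: norm_divide norm_mult) simp
  then show ?thesis
    using assms n by (simp add: pick_dist_def power_divide power_mult_distrib)
qed

lemma unit_circle_cayley_real:
  assumes "cmod a = 1" "a \<noteq> 1"
  obtains x :: real where "a = (of_real x - \<i>) / (of_real x + \<i>)" "2 * \<i> / (1 - a) - \<i> = of_real x"
proof -
  define q where "q = 2 * \<i> / (1 - a) - \<i>"
  have n: "1 - a \<noteq> 0" using assms by auto
  have a2: "(Re a)\<^sup>2 + (Im a)\<^sup>2 = 1" using assms by (simp add: cmod_power2[symmetric])
  \<comment> \<open>On the unit circle the squared modulus of \<open>1 - a\<close> is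
    \<open>2 * (1 - Re a)\<close>, which is exactly what makes the inverse Cayley image
    \<open>q\<close> real.\<close>
  have s: "(1 - Re a)\<^sup>2 + (Im a)\<^sup>2 = 2 * (1 - Re a)"
    using a2 by (simp add: power2_eq_square algebra_simps)
  then have "1 - Re a \<noteq> 0" using n by (auto simp: complex_eq_iff)
  moreover have "Im q = 2 * (1 - Re a) / ((1 - Re a)\<^sup>2 + (Im a)\<^sup>2) - 1"
    by (simp add: q_def Im_divide)
  ultimately have "Im q = 0" unfolding s by simp
  then have q: "q = of_real (Re q)" by (simp add: complex_eq_iff)
  have q': "q + \<i> = 2 * \<i> / (1 - a)" "q - \<i> = 2 * \<i> * a / (1 - a)"
    using n by (auto simp: q_def field_simps)
  then have "a = (q - \<i>) / (q + \<i>)" unfolding q' using n by simp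
  then show thesis using that q q_def by metis
qed

text \<open>The formula \<open>2 * \<i> / (1 - b) - \<i>\<close> is the inverse Cayley transform. It
  carries limits in the disc back to the half-plane, with 1 corresponding to infinity.\<close>

lemma tendsto_of_cayley:
  assumes "((\<lambda>w. pick_map \<i> (k w)) \<longlongrightarrow> b) F" "eventually (\<lambda>w. 0 < Im (k w)) F"
  shows "b \<noteq> 1 \<Longrightarrow> (k \<longlongrightarrow> 2 * \<i> / (1 - b) - \<i>) F"
    and "b = 1 \<Longrightarrow> filterlim k at_infinity F"
proof -
  have eq: "2 * \<i> / (1 - pick_map \<i> w) - \<i> = w" and ne: "1 - pick_map \<i> w \<noteq> 0" if "0 < Im w" for w
  proof -
    have n: "w + \<i> \<noteq> 0" using that by (auto simp: complex_eq_iff)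
    have 1: "1 - pick_map \<i> w = 2 * \<i> / (w + \<i>)" using n by (simp add: pick_map_def field_simps)
    show "2 * \<i> / (1 - pick_map \<i> w) - \<i> = w" "1 - pick_map \<i> w \<noteq> 0" unfolding 1 using n by auto
  qed
  have ev: "eventually (\<lambda>w. 2 * \<i> / (1 - pick_map \<i> (k w)) - \<i> = k w) F"
    using assms(2) by eventually_elim (rule eq)
  show "(k \<longlongrightarrow> 2 * \<i> / (1 - b) - \<i>) F" if "b \<noteq> 1"
  proof (rule Lim_transform_eventually[OF _ ev])
    show "((\<lambda>w. 2 * \<i> / (1 - pick_map \<i> (k w)) - \<i>) \<longlongrightarrow> 2 * \<i> / (1 - b) - \<i>) F"
      using that by (intro tendsto_intros assms) auto
  qed
  show "filterlim k at_infinity F" if b: "b = 1"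
  proof -
    have "((\<lambda>w. 1 - pick_map \<i> (k w)) \<longlongrightarrow> 1 - b) F" by (intro tendsto_intros assms)
    then have "filterlim (\<lambda>w. 1 - pick_map \<i> (k w)) (at 0) F"
      using b assms(2) ne by (auto simp: filterlim_at elim: eventually_mono)
    then have "filterlim (\<lambda>w. inverse (1 - pick_map \<i> (k w))) at_infinity F"
      by (rule filterlim_compose[OF filterlim_inverse_at_infinity])
    then have "filterlim (\<lambda>w. 2 * \<i> / (1 - pick_map \<i> (k w))) at_infinity F"
      unfolding divide_inverse by (intro tendsto_mult_filterlim_at_infinity[OF tendsto_const]) auto
    then have "filterlim (\<lambda>w. 2 * \<i> / (1 - pick_map \<i> (k w)) + (- \<i>)) at_infinity F"
      by (rule tendsto_add_filterlim_at_infinity'[OF _ tendsto_const])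
    then show ?thesis
      by (rule filterlim_mono_eventually) (use ev in auto)
  qed
qed

lemma tendsto_of_norm_diff_power2:
  fixes d :: "'a \<Rightarrow> complex"
  assumes "(\<phi> \<longlongrightarrow> 0) F" "eventually (\<lambda>w. (cmod (b - d w))\<^sup>2 \<le> \<phi> w) F"
  shows "(d \<longlongrightarrow> b) F"
proof -
  have "((\<lambda>w. (cmod (b - d w))\<^sup>2) \<longlongrightarrow> 0) F"
    by (rule tendsto_sandwich[OF _ assms(2) tendsto_const assms(1)]) auto
  then have "((\<lambda>w. cmod (b - d w)) \<longlongrightarrow> 0) F"
    using tendsto_real_sqrt by fastforce
  then have "((\<lambda>w. b - (b - d w)) \<longlongrightarrow> b - 0) F"
    by (intro tendsto_intros) (rule tendsto_norm_zero_cancel)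
  then show ?thesis by simp
qed

text \<open>If no bound existed, Julia's lemma would supply \<open>a\<close> and \<open>b\<close> on
  the unit circle. The right-hand side of its inequality tends to 0 along every cone at the boundary
  point \<open>a\<close>, so \<open>k\<close> would have there the real or infinite limit
  corresponding to \<open>b\<close>, against \<open>fin\<close> or \<open>inf\<close>.\<close>

lemma pick_dist_bounded_if_no_boundary_limit:
  assumes hol: "k holomorphic_on uhp" and k: "\<And>w. 0 < Im w \<Longrightarrow> 0 < Im (k w)"
    and fin: "\<forall>x::real. (\<forall>L. nt_lim k x L \<longrightarrow> Im L > 0) \<and> \<not> nt_lim_infty_val k x"
    and inf: "(\<forall>L. nt_lim_at_inf k L \<longrightarrow> Im L > 0) \<and> \<not> nt_lim_at_inf_infty_val k"
  shows "\<exists>B. \<forall>w. 0 < Im w \<and> pick_dist w \<i> \<le> C * pick_dist (k w) \<i> \<longrightarrow> pick_dist w \<i> \<le> B"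
proof (rule ccontr)
  assume "\<not> ?thesis"
  then obtain a b where ab: "cmod a = 1" "cmod b = 1" "C > 0" and
    le: "\<And>w. 0 < Im w \<Longrightarrow>
      (cmod (b - pick_map \<i> (k w)))\<^sup>2 \<le> C * ((cmod (a - pick_map \<i> w))\<^sup>2 * pick_dist w \<i>)"
    using julia[OF hol k] by blast
  show False
  proof (cases "a = 1")
    case True
    have lim: "((\<lambda>w. pick_map \<i> (k w)) \<longlongrightarrow> b) (inf at_infinity (principal (nt_cone_inf c)))"
      and ev: "eventually (\<lambda>w. 0 < Im (k w)) (inf at_infinity (principal (nt_cone_inf c)))"
      if c: "c > 0" for c
    proof -
      let ?F = "inf at_infinity (principal (nt_cone_inf c))"
      show "eventually (\<lambda>w. 0 < Im (k w)) ?F"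
        unfolding eventually_inf_principal by (auto simp: nt_cone_inf_def k)
      have at: "filterlim cmod at_top ?F"
        by (rule filterlim_mono[OF filterlim_norm_at_top]) auto
      have "((\<lambda>w. C * (4 * (1 + c)) / cmod w) \<longlongrightarrow> 0) ?F"
        by (intro tendsto_divide_0[OF tendsto_const] filterlim_at_top_imp_at_infinity at)
      moreover have "eventually (\<lambda>w. (cmod (b - pick_map \<i> (k w)))\<^sup>2 \<le> C * (4 * (1 + c)) / cmod w) ?F"
        unfolding eventually_inf_principal
      proof (intro always_eventually allI impI)
        fix w assume w: "w \<in> nt_cone_inf c"
        then have w0: "0 < Im w" by (simp add: nt_cone_inf_def)
        then have w1: "0 < cmod w" by auto
        \<comment> \<open>Inside the cone \<open>cmod w\<close> and \<open>Im w\<close> are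
          comparable, with the constant \<open>1 + c\<close>.\<close>
        have "cmod w \<le> \<bar>Re w\<bar> + \<bar>Im w\<bar>" by (rule cmod_le)
        then have "cmod w \<le> (1 + c) * Im w" using w by (simp add: nt_cone_inf_def algebra_simps)
        then have "4 / Im w \<le> 4 * (1 + c) / cmod w" using w0 w1 by (simp add: field_simps)
        then have "C * (4 / Im w) \<le> C * (4 * (1 + c) / cmod w)" using ab by (intro mult_left_mono) auto
        then show "(cmod (b - pick_map \<i> (k w)))\<^sup>2 \<le> C * (4 * (1 + c)) / cmod w"
          using le[OF w0] cayley_boundary_infinity[OF w0] True by simp
      qed
      ultimately show "((\<lambda>w. pick_map \<i> (k w)) \<longlongrightarrow> b) ?F"
        by (rule tendsto_of_norm_diff_power2)
    qed
    show False
    proof (cases "b = 1")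
      case True
      then have "nt_lim_at_inf_infty_val k"
        unfolding nt_lim_at_inf_infty_val_def using tendsto_of_cayley(2)[OF lim ev] by auto
      then show False using inf by simp
    next
      case False
      then obtain y where y: "2 * \<i> / (1 - b) - \<i> = of_real y"
        using unit_circle_cayley_real ab by metis
      have "nt_lim_at_inf k (of_real y)"
        unfolding nt_lim_at_inf_def using tendsto_of_cayley(1)[OF lim ev False] y by auto
      then show False using inf by fastforce
    qed
  next
    case False
    obtain x :: real where x: "a = (of_real x - \<i>) / (of_real x + \<i>)"
      using unit_circle_cayley_real[OF ab(1) False] by metis
    have lim: "((\<lambda>w. pick_map \<i> (k w)) \<longlongrightarrow> b) (at (of_real x) within nt_cone x c)"
      and ev: "eventually (\<lambda>w. 0 < Im (k w)) (at (of_real x) within nt_cone x c)"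
      if c: "c > 0" for c
    proof -
      let ?F = "at (complex_of_real x) within nt_cone x c"
      let ?K = "4 / (cmod (of_real x + \<i>))\<^sup>2"
      show "eventually (\<lambda>w. 0 < Im (k w)) ?F"
        unfolding eventually_at_filter by (auto simp: nt_cone_def k)
      have "((\<lambda>w. C * (?K * ((1 + c) * cmod (w - of_real x)))) \<longlongrightarrow>
              C * (?K * ((1 + c) * cmod (of_real x - of_real x)))) ?F"
        by (intro tendsto_intros)
      then have "((\<lambda>w. C * (?K * ((1 + c) * cmod (w - of_real x)))) \<longlongrightarrow> 0) ?F" by simp
      moreover have "eventually (\<lambda>w. (cmod (b - pick_map \<i> (k w)))\<^sup>2 \<le> C * (?K * ((1 + c) * cmod (w - of_real x)))) ?F"
        unfolding eventually_at_filter
      proof (intro always_eventually allI impI)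
        fix w assume w: "w \<in> nt_cone x c"
        then have w0: "0 < Im w" by (simp add: nt_cone_def)
        have "cmod (w - of_real x) \<le> \<bar>Re w - x\<bar> + \<bar>Im w\<bar>" using cmod_le[of "w - of_real x"] by simp
        then have "cmod (w - of_real x) \<le> (1 + c) * Im w" using w by (simp add: nt_cone_def algebra_simps)
        then have "cmod (w - of_real x) * cmod (w - of_real x) \<le> ((1 + c) * Im w) * cmod (w - of_real x)"
          by (intro mult_right_mono) auto
        then have "(cmod (w - of_real x))\<^sup>2 / Im w \<le> (1 + c) * cmod (w - of_real x)"
          using w0 by (simp add: field_simps power2_eq_square)
        then have "C * (?K * ((cmod (w - of_real x))\<^sup>2 / Im w)) \<le> C * (?K * ((1 + c) * cmod (w - of_real x)))"
          using ab by (intro mult_left_mono) auto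
        then show "(cmod (b - pick_map \<i> (k w)))\<^sup>2 \<le> C * (?K * ((1 + c) * cmod (w - of_real x)))"
          using le[OF w0] unfolding x cayley_boundary_real[OF w0] by linarith
      qed
      ultimately show "((\<lambda>w. pick_map \<i> (k w)) \<longlongrightarrow> b) ?F"
        by (rule tendsto_of_norm_diff_power2)
    qed
    show False
    proof (cases "b = 1")
      case True
      then have "nt_lim_infty_val k x"
        unfolding nt_lim_infty_val_def using tendsto_of_cayley(2)[OF lim ev] by auto
      then show False using fin by blast
    next
      case False
      then obtain y where y: "2 * \<i> / (1 - b) - \<i> = of_real y"
        using unit_circle_cayley_real ab by metis
      have "nt_lim k x (of_real y)"
        unfolding nt_lim_def using tendsto_of_cayley(1)[OF lim ev False] y by auto
      then show False using fin by fastforce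
    qed
  qed
qed

section \<open>Fixed points and subordination\<close>

text \<open>
  A value \<open>\<omega> z\<close> of the subordination function of \<open>\<mu>\<close> is a fixed point of
  \<open>w \<mapsto> z + g (z + k w)\<close> for \<open>k = h\<^sub>\<mu>\<close> and \<open>g = h\<^sub>\<nu>\<close>.
  The assumption \<open>proper\<close> is what remains of the hypothesis on nontangential limits.
\<close>

locale subordination =
  fixes k g :: "complex \<Rightarrow> complex"
  assumes k_holo: "k holomorphic_on uhp" and k_uhp: "0 < Im w \<Longrightarrow> 0 < Im (k w)"
    and g_holo: "g holomorphic_on uhp" and g_uhp: "0 < Im w \<Longrightarrow> 0 < Im (g w)"
    and proper: "\<exists>B. \<forall>w. 0 < Im w \<and> pick_dist w \<i> \<le> C * pick_dist (k w) \<i> \<longrightarrow> pick_dist w \<i> \<le> B"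
begin

definition iter :: "complex \<Rightarrow> complex \<Rightarrow> complex" where
  "iter z w = z + g (z + k w)"

definition sub_point :: "complex \<Rightarrow> complex \<Rightarrow> bool" where
  "sub_point z w \<longleftrightarrow> 0 < Im w \<and> iter z w = w"

text \<open>Were one pair not strictly contracted, rigidity would make \<open>k\<close> preserve all
  distances to \<open>v\<close>. Then \<open>pick_dist u \<i>\<close> is dominated by a multiple of
  \<open>pick_dist (k u) \<i>\<close> for every \<open>u\<close>, and \<open>proper\<close> would
  bound the whole half-plane.\<close>

lemma k_strict_contraction:
  assumes w: "0 < Im w" and v: "0 < Im v" and "w \<noteq> v"
  shows "pick_dist (k w) (k v) < pick_dist w v"
proof (rule ccontr)
  assume "\<not> ?thesis"
  then have rigid: "pick_dist u v \<le> pick_dist (k u) (k v)" if "0 < Im u" for u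
    using schwarz_pick_rigid[OF k_holo k_uhp v w \<open>w \<noteq> v\<close> _ that] by simp
  define C1 where "C1 = (1 + cmod (v - \<i>) / Im v)\<^sup>2 * Im v / Im \<i>"
  define C2 where "C2 = (1 + cmod (\<i> - k v) / Im \<i>)\<^sup>2 * Im \<i> / Im (k v)"
  have C1: "C1 \<ge> 0" unfolding C1_def using v by simp
  have *: "pick_dist u \<i> \<le> C1 * C2 * pick_dist (k u) \<i>" if u: "0 < Im u" for u
  proof -
    have "pick_dist u \<i> \<le> C1 * pick_dist u v"
      unfolding C1_def by (rule pick_dist_basepoint_le) (use u v in auto)
    also have "\<dots> \<le> C1 * pick_dist (k u) (k v)"
      using rigid[OF u] C1 by (rule mult_left_mono)
    also have "pick_dist (k u) (k v) \<le> C2 * pick_dist (k u) \<i>"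
      unfolding C2_def by (rule pick_dist_basepoint_le) (use u v k_uhp in auto)
    finally show ?thesis using C1 by (simp add: mult.assoc mult_left_mono)
  qed
  then obtain B where B: "\<And>u. 0 < Im u \<Longrightarrow> pick_dist u \<i> \<le> B"
    using proper[of "C1 * C2"] by blast
  \<comment> \<open>Points high on the imaginary axis exceed any bound: at height \<open>y\<close>
    the value is \<open>(y + 1)\<^sup>2 / y\<close>.\<close>
  define y where "y = \<bar>B\<bar> + 1"
  have y: "y > 0" by (simp add: y_def)
  have "\<i> * of_real y + \<i> = \<i> * of_real (y + 1)" by (simp add: algebra_simps)
  then have "cmod (\<i> * of_real y + \<i>) = y + 1" using y by (simp only: norm_mult norm_of_real) simp
  then have "pick_dist (\<i> * of_real y) \<i> = (y + 1)\<^sup>2 / y" by (simp add: pick_dist_def)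
  also have "\<dots> \<ge> y" using y by (simp add: field_simps power2_eq_square)
  finally have "y \<le> B" using B[of "\<i> * of_real y"] y by simp
  then show False by (simp add: y_def)
qed

section \<open>Contraction and derivative of the fixed-point map\<close>

lemma iter_uhp: "0 \<le> Im z \<Longrightarrow> 0 < Im w \<Longrightarrow> 0 < Im (iter z w)"
  using g_uhp[of "z + k w"] k_uhp[of w] by (simp add: iter_def)

lemma iter_strict_contraction:
  assumes z: "0 \<le> Im z" and w: "0 < Im w" and v: "0 < Im v" and "w \<noteq> v"
  shows "pick_dist (iter z w) (iter z v) < pick_dist w v"
proof -
  have pos: "0 < Im (z + k w)" "0 < Im (z + k v)" using z k_uhp[OF w] k_uhp[OF v] by simp_all
  have "pick_dist (iter z w) (iter z v) \<le> pick_dist (g (z + k w)) (g (z + k v))"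
    unfolding iter_def using z pos g_uhp by (intro pick_dist_add_le) auto
  also have "\<dots> \<le> pick_dist (z + k w) (z + k v)"
    by (rule schwarz_pick[OF g_holo g_uhp]) (use pos in auto)
  also have "\<dots> \<le> pick_dist (k w) (k v)"
    using z k_uhp w v by (intro pick_dist_add_le) auto
  also have "\<dots> < pick_dist w v" by (rule k_strict_contraction[OF w v \<open>w \<noteq> v\<close>])
  finally show ?thesis .
qed

lemma sub_point_unique:
  assumes "0 \<le> Im z" "sub_point z w" "sub_point z v"
  shows "w = v"
  using iter_strict_contraction[OF assms(1), of w v] assms by (auto simp: sub_point_def)

lemma iter_has_derivative:
  assumes "0 < Im w" "0 < Im (z + k w)"
  shows "(iter z has_field_derivative deriv g (z + k w) * deriv k w) (at w)"
proof -
  have 1: "(k has_field_derivative deriv k w) (at w)"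
    using k_holo assms by (simp add: holomorphic_derivI open_halfspace_Im_gt)
  have 2: "(g has_field_derivative deriv g (z + k w)) (at (z + k w))"
    using g_holo assms by (simp add: holomorphic_derivI open_halfspace_Im_gt)
  have "((\<lambda>w. z + k w) has_field_derivative deriv k w) (at w)"
    using 1 by (auto intro!: derivative_eq_intros)
  from DERIV_chain2[of g _ "\<lambda>w. z + k w", OF 2 this] show ?thesis
    unfolding iter_def by (auto intro!: derivative_eq_intros)
qed

lemma iter_holomorphic:
  assumes "0 \<le> Im z"
  shows "iter z holomorphic_on uhp"
proof (rule holomorphic_onI)
  fix w assume "w \<in> uhp"
  then show "iter z field_differentiable at w within uhp"
    using iter_has_derivative[of w z] k_uhp[of w] assms
    by (auto simp: field_differentiable_def intro: has_field_derivative_at_within)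
qed

lemma norm_deriv_iter_less_1:
  assumes z: "0 \<le> Im z" and "sub_point z w"
  shows "cmod (deriv g (z + k w) * deriv k w) < 1"
proof -
  have w: "0 < Im w" "iter z w = w" using assms by (auto simp: sub_point_def)
  have "cmod (deriv (iter z) w) < 1"
    \<comment> \<open>Any second point of the half-plane will do to test strict contraction;
      \<open>w + \<i>\<close> is one.\<close>
    by (rule norm_deriv_fixpoint_less_1[OF iter_holomorphic[OF z] iter_uhp[OF z] w, of "w + \<i>"])
       (use w z iter_strict_contraction[of z "w + \<i>" w] in auto)
  moreover have "deriv (iter z) w = deriv g (z + k w) * deriv k w"
    using iter_has_derivative[of w z] w k_uhp[of w] z by (intro DERIV_imp_deriv) auto
  ultimately show ?thesis by simp
qed

text \<open>The fixed-point equation leads from \<open>k w\<close> to \<open>w\<close> by a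
  translation, \<open>g\<close> and another translation. Each costs a constant factor, so
  \<open>proper\<close> applies with a constant \<open>C'\<close> that depends on \<open>R\<close>
  but not on \<open>z\<close>.\<close>

lemma sub_point_bounded:
  obtains B where "\<And>z w. 0 \<le> Im z \<Longrightarrow> cmod z \<le> R \<Longrightarrow> sub_point z w \<Longrightarrow> pick_dist w \<i> \<le> B"
proof -
  obtain C where C: "C \<ge> 0" "\<And>w. 0 < Im w \<Longrightarrow> pick_dist (g w) \<i> \<le> C * pick_dist w \<i>"
    using pick_dist_self_map_le[OF g_holo g_uhp] by blast
  define C' where "C' = (1 + R)\<^sup>2 * (C * (1 + R)\<^sup>2)"
  obtain B where B: "\<And>w. 0 < Im w \<Longrightarrow> pick_dist w \<i> \<le> C' * pick_dist (k w) \<i> \<Longrightarrow> pick_dist w \<i> \<le> B"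
    using proper[of C'] by blast
  show thesis
  proof (rule that[of B])
    fix z w assume z: "0 \<le> Im z" "cmod z \<le> R" and "sub_point z w"
    then have w: "0 < Im w" "w = z + g (z + k w)" by (auto simp: sub_point_def iter_def)
    have u: "0 < Im (z + k w)" using z k_uhp[OF w(1)] by simp
    have "pick_dist (z + g (z + k w)) \<i> \<le> (1 + R)\<^sup>2 * pick_dist (g (z + k w)) \<i>"
      using z u g_uhp by (intro pick_dist_translate_le) auto
    also have "\<dots> \<le> (1 + R)\<^sup>2 * (C * pick_dist (z + k w) \<i>)"
      using C(2)[OF u] by (intro mult_left_mono) auto
    also have "\<dots> \<le> (1 + R)\<^sup>2 * (C * ((1 + R)\<^sup>2 * pick_dist (k w) \<i>))"
      using z k_uhp[OF w(1)] C(1) by (intro mult_left_mono pick_dist_translate_le) auto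
    finally have "pick_dist w \<i> \<le> C' * pick_dist (k w) \<i>"
      unfolding w(2)[symmetric] by (simp add: C'_def mult.assoc)
    then show "pick_dist w \<i> \<le> B" by (rule B[OF w(1)])
  qed
qed

section \<open>Existence and local analyticity of fixed points\<close>

lemma isCont_k: "0 < Im w \<Longrightarrow> isCont k w"
  using holomorphic_on_imp_continuous_on[OF k_holo]
  by (simp add: continuous_on_eq_continuous_at open_halfspace_Im_gt)

lemma isCont_g: "0 < Im w \<Longrightarrow> isCont g w"
  using holomorphic_on_imp_continuous_on[OF g_holo]
  by (simp add: continuous_on_eq_continuous_at open_halfspace_Im_gt)

text \<open>Over a convergent sequence of parameters the fixed points stay in one compact hyperbolic
  ball. A subsequence thus converges inside the open half-plane, and continuity passes the equation
  to the limit.\<close>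

lemma closed_sub_points: "closed {z. 0 \<le> Im z \<and> (\<exists>w. sub_point z w)}"
  unfolding closed_sequential_limits
proof (intro allI impI, elim conjE)
  fix x l assume x: "\<forall>n. x n \<in> {z. 0 \<le> Im z \<and> (\<exists>w. sub_point z w)}" and l: "x \<longlonglongrightarrow> l"
  have x0: "0 \<le> Im (x n)" for n using x by auto
  have l0: "0 \<le> Im l" using x0 by (intro LIMSEQ_le_const[OF tendsto_Im[OF l]]) auto
  obtain w where w: "\<And>n. sub_point (x n) (w n)" using x by (simp add: choice_iff) metis
  obtain R where R: "\<And>n. cmod (x n) \<le> R"
    using convergent_imp_bounded[OF l] by (auto simp: bounded_iff)
  obtain B where B: "\<And>z w. 0 \<le> Im z \<Longrightarrow> cmod z \<le> R \<Longrightarrow> sub_point z w \<Longrightarrow> pick_dist w \<i> \<le> B"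
    by (rule sub_point_bounded[of R]) blast
  have mem: "\<forall>n. w n \<in> {w. 0 < Im w \<and> pick_dist w \<i> \<le> B}"
    using B[OF x0 R w] w by (auto simp: sub_point_def)
  obtain v r where v: "v \<in> {w. 0 < Im w \<and> pick_dist w \<i> \<le> B}" and r: "strict_mono r" "(w \<circ> r) \<longlonglongrightarrow> v"
    by (rule seq_compactE[OF compact_imp_seq_compact[OF compact_pick_ball] mem])
  have v0: "0 < Im v" using v by simp
  have w': "(\<lambda>n. w (r n)) \<longlonglongrightarrow> v" using r(2) by (simp add: o_def)
  have x': "(\<lambda>n. x (r n)) \<longlonglongrightarrow> l" using LIMSEQ_subseq_LIMSEQ[OF l r(1)] by (simp add: o_def)
  have "(\<lambda>n. x (r n) + g (x (r n) + k (w (r n)))) \<longlonglongrightarrow> l + g (l + k v)"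
    by (intro tendsto_add x' isCont_tendsto_compose[OF isCont_g] isCont_tendsto_compose[OF isCont_k] w')
       (use v0 l0 k_uhp[of v] in auto)
  moreover have "(\<lambda>n. x (r n) + g (x (r n) + k (w (r n)))) = (\<lambda>n. w (r n))"
    using w by (auto simp: sub_point_def iter_def)
  ultimately have "l + g (l + k v) = v" using w' LIMSEQ_unique by auto
  then show "l \<in> {z. 0 \<le> Im z \<and> (\<exists>w. sub_point z w)}"
    using v0 l0 by (auto simp: sub_point_def iter_def)
qed

text \<open>A holomorphic implicit function argument by Picard iteration. For real \<open>z0\<close>
  the ball leaves the closed half-plane, where hyperbolic contraction fails to apply; the derivative
  bound at \<open>w0\<close> gives a Euclidean contraction instead. This is the source of the
  continuation across the real line.\<close>

lemma sub_point_local_holomorphic: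
  assumes z0: "0 \<le> Im z0" and w0: "sub_point z0 w0"
  obtains \<delta> \<omega> where "\<delta> > 0" "\<omega> holomorphic_on ball z0 \<delta>" "\<And>z. z \<in> ball z0 \<delta> \<Longrightarrow> sub_point z (\<omega> z)"
proof -
  let ?D = "\<lambda>p. deriv g (fst p + k (snd p)) * deriv k (snd p)"
  have w0': "0 < Im w0" "iter z0 w0 = w0" "0 < Im (z0 + k w0)"
    using z0 w0 k_uhp[of w0] by (auto simp: sub_point_def)
  obtain q where q: "cmod (?D (z0, w0)) < q" "q < 1"
    using norm_deriv_iter_less_1[OF z0 w0] dense by auto
  have q0: "0 \<le> q" using q(1) norm_ge_zero less_imp_le order_trans by blast
  have dk: "isCont (deriv k) w0"
    using holomorphic_on_imp_continuous_on[OF holomorphic_deriv[OF k_holo]] w0'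
    by (simp add: continuous_on_eq_continuous_at open_halfspace_Im_gt)
  have dg: "isCont (deriv g) (z0 + k w0)"
    using holomorphic_on_imp_continuous_on[OF holomorphic_deriv[OF g_holo]] w0'
    by (simp add: continuous_on_eq_continuous_at open_halfspace_Im_gt)
  have lf: "(fst \<longlongrightarrow> z0) (nhds (z0, w0))" and ls: "(snd \<longlongrightarrow> w0) (nhds (z0, w0))"
    using tendsto_fst[of "\<lambda>x. x" "(z0, w0)"] tendsto_snd[of "\<lambda>x. x" "(z0, w0)"] by (auto simp: filterlim_ident)
  have lk: "((\<lambda>p. fst p + k (snd p)) \<longlongrightarrow> z0 + k w0) (nhds (z0, w0))"
    by (intro tendsto_add lf isCont_tendsto_compose[OF isCont_k] ls w0')
  have lD: "((\<lambda>p. cmod (?D p)) \<longlongrightarrow> cmod (?D (z0, w0))) (nhds (z0, w0))"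
    using isCont_tendsto_compose[OF dg lk] isCont_tendsto_compose[OF dk ls]
    by (auto intro!: tendsto_intros)
  have "\<forall>\<^sub>F p in nhds (z0, w0). 0 < Im (snd p) \<and> 0 < Im (fst p + k (snd p)) \<and> cmod (?D p) < q"
    using order_tendstoD(1)[OF tendsto_Im[OF ls] w0'(1)] order_tendstoD(1)[OF tendsto_Im[OF lk] w0'(3)]
      order_tendstoD(2)[OF lD q(1)]
    by eventually_elim auto
  then obtain d where d: "d > 0" "\<And>z w. dist (z, w) (z0, w0) < d \<Longrightarrow>
      0 < Im w \<and> 0 < Im (z + k w) \<and> cmod (deriv g (z + k w) * deriv k w) < q"
    unfolding eventually_nhds_metric by auto
  \<comment> \<open>\<open>z\<close> and \<open>w\<close> each move by at most \<open>r\<close>, so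
    the pair moves by at most \<open>d / 2\<close>.\<close>
  define r where "r = d / 4"
  have r: "r > 0" using d by (simp add: r_def)
  have D: "0 < Im w \<and> 0 < Im (z + k w) \<and> cmod (deriv g (z + k w) * deriv k w) < q"
    if "z \<in> ball z0 r" "w \<in> cball w0 r" for z w
  proof (rule d(2))
    have "dist (z, w) (z0, w0) \<le> dist z z0 + dist w w0"
      unfolding dist_Pair_Pair by (rule sqrt_sum_squares_le_sum) auto
    then show "dist (z, w) (z0, w0) < d" using that d(1) by (auto simp: r_def dist_commute)
  qed
  \<comment> \<open>If the centre moves by less than \<open>(1 - q) * r\<close>, a contraction with
    factor \<open>q\<close> maps the closed ball of radius \<open>r\<close> into itself.\<close>
  have "((\<lambda>z. iter z w0) \<longlongrightarrow> iter z0 w0) (nhds z0)"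
    unfolding iter_def
    by (intro tendsto_add isCont_tendsto_compose[OF isCont_g[OF w0'(3)]] tendsto_const filterlim_ident)
  then have "\<forall>\<^sub>F z in nhds z0. dist (iter z w0) w0 < (1 - q) * r"
    using tendstoD[of _ _ _ "(1 - q) * r"] r q w0' by auto
  then obtain e where e: "e > 0" "\<And>z. dist z z0 < e \<Longrightarrow> dist (iter z w0) w0 < (1 - q) * r"
    unfolding eventually_nhds_metric by auto
  define \<delta> where "\<delta> = min e r"
  have \<delta>: "\<delta> > 0" "ball z0 \<delta> \<subseteq> ball z0 r" using e r by (auto simp: \<delta>_def)
  have lip: "dist (iter z w) (iter z v) \<le> q * dist w v"
    if "z \<in> ball z0 \<delta>" "w \<in> cball w0 r" "v \<in> cball w0 r" for z w v
    unfolding dist_norm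
  proof (rule field_differentiable_bound[OF convex_cball _ _ that(2,3)])
    fix u assume u: "u \<in> cball w0 r"
    have "z \<in> ball z0 r" using that \<delta> by blast
    note D = D[OF this u]
    show "(iter z has_field_derivative deriv g (z + k u) * deriv k u) (at u within cball w0 r)"
      using iter_has_derivative D by (auto intro: has_field_derivative_at_within)
    show "cmod (deriv g (z + k u) * deriv k u) \<le> q" using D by simp
  qed
  have self: "iter z w \<in> cball w0 r" if "z \<in> ball z0 \<delta>" "w \<in> cball w0 r" for z w
  proof -
    have "dist (iter z w) w0 \<le> dist (iter z w) (iter z w0) + dist (iter z w0) w0" by (rule dist_triangle)
    also have "dist (iter z w) (iter z w0) \<le> q * dist w w0" using that r by (intro lip) auto
    also have "\<dots> \<le> q * r" using that q0 by (intro mult_left_mono) (auto simp: dist_commute)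
    also have "dist (iter z w0) w0 \<le> (1 - q) * r"
      using that e(2)[of z] by (auto simp: \<delta>_def dist_commute)
    finally show ?thesis by (simp add: dist_commute algebra_simps)
  qed
  have "\<exists>w. w \<in> cball w0 r \<and> iter z w = w" if "z \<in> ball z0 \<delta>" for z
  proof -
    have "\<exists>!w\<in>cball w0 r. iter z w = w"
      by (rule Banach_fix[OF _ _ q0 q(2)])
         (use r self[OF that] lip[OF that] in \<open>auto simp: complete_eq_closed\<close>)
    then show ?thesis by auto
  qed
  then obtain \<omega> where \<omega>: "\<And>z. z \<in> ball z0 \<delta> \<Longrightarrow> \<omega> z \<in> cball w0 r"
      "\<And>z. z \<in> ball z0 \<delta> \<Longrightarrow> iter z (\<omega> z) = \<omega> z"
    by metis
  \<comment> \<open>The iterates start from a constant and are holomorphic in \<open>z\<close>. They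
    converge at the rate \<open>q ^ n\<close> uniformly in \<open>z\<close>, so the fixed point is
    holomorphic too.\<close>
  define W where "W = (\<lambda>n z. (iter z ^^ n) w0)"
  have W: "W 0 z = w0" "W (Suc n) z = iter z (W n z)" for n z by (auto simp: W_def)
  have W_mem: "W n z \<in> cball w0 r" if "z \<in> ball z0 \<delta>" for n z
  proof (induction n)
    case 0
    then show ?case using r by (simp add: W)
  next
    case (Suc n)
    then show ?case unfolding W by (rule self[OF that])
  qed
  have W_holo: "W n holomorphic_on ball z0 \<delta>" for n
  proof (induction n)
    case 0
    then show ?case by (simp add: W)
  next
    case (Suc n)
    have kW: "(\<lambda>z. k (W n z)) holomorphic_on ball z0 \<delta>"
      by (rule holomorphic_on_compose_gen[OF Suc k_holo, unfolded o_def])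
         (use W_mem D \<delta> in blast)
    have "(\<lambda>z. g (z + k (W n z))) holomorphic_on ball z0 \<delta>"
      by (rule holomorphic_on_compose_gen[OF _ g_holo, unfolded o_def])
         (use W_mem D \<delta> kW in \<open>auto intro!: holomorphic_intros\<close>)
    then show ?case
      unfolding W iter_def by (intro holomorphic_intros)
  qed
  have W_lim: "dist (W n z) (\<omega> z) \<le> q ^ n * r" if z: "z \<in> ball z0 \<delta>" for n z
  proof (induction n)
    case 0
    then show ?case using \<omega>(1)[OF z] by (simp add: W)
  next
    case (Suc n)
    have "dist (W (Suc n) z) (\<omega> z) = dist (iter z (W n z)) (iter z (\<omega> z))"
      using \<omega>(2)[OF z] by (simp add: W)
    also have "\<dots> \<le> q * dist (W n z) (\<omega> z)" using z W_mem \<omega> by (intro lip)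
    also have "\<dots> \<le> q * (q ^ n * r)" using Suc q0 by (rule mult_left_mono)
    finally show ?case by simp
  qed
  have unif: "uniform_limit (ball z0 \<delta>) W \<omega> sequentially"
  proof (rule uniform_limitI)
    fix \<epsilon> :: real assume "\<epsilon> > 0"
    have "(\<lambda>n. q ^ n * r) \<longlonglongrightarrow> 0 * r"
      by (intro tendsto_intros LIMSEQ_power_zero) (use q0 q in auto)
    then have "\<forall>\<^sub>F n in sequentially. q ^ n * r < \<epsilon>"
      using order_tendstoD(2)[of _ 0] \<open>\<epsilon> > 0\<close> by simp
    then show "\<forall>\<^sub>F n in sequentially. \<forall>z\<in>ball z0 \<delta>. dist (W n z) (\<omega> z) < \<epsilon>"
      by eventually_elim (use W_lim le_less_trans in blast)
  qed
  have "\<omega> holomorphic_on ball z0 \<delta>"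
  proof (rule holomorphic_uniform_sequence[OF open_ball W_holo])
    fix x assume "x \<in> ball z0 \<delta>"
    then obtain d where "d > 0" "cball x d \<subseteq> ball z0 \<delta>"
      using open_contains_cball[THEN iffD1, OF open_ball] by blast
    then show "\<exists>d>0. cball x d \<subseteq> ball z0 \<delta> \<and> uniform_limit (cball x d) W \<omega> sequentially"
      using uniform_limit_on_subset[OF unif] by blast
  qed
  moreover have "sub_point z (\<omega> z)" if "z \<in> ball z0 \<delta>" for z
    using D[of z "\<omega> z"] \<omega> that \<delta> by (auto simp: sub_point_def)
  ultimately show thesis using that \<delta>(1) by blast
qed

text \<open>The parameters with a fixed point form a nonempty clopen subset of the connected closed
  half-plane. Uniqueness identifies the chosen fixed point with each local solution \<open>W\<close>
  there; below the real line only the local continuations are used.\<close>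

lemma subordination_function:
  assumes "0 \<le> Im z1" "sub_point z1 w1"
  obtains \<omega> where "\<And>z. 0 \<le> Im z \<Longrightarrow> sub_point z (\<omega> z)"
    "\<And>z0. 0 \<le> Im z0 \<Longrightarrow> \<exists>\<delta>>0. \<exists>W. W holomorphic_on ball z0 \<delta> \<and>
       (\<forall>z\<in>ball z0 \<delta>. 0 < Im (W z) \<and> (0 \<le> Im z \<longrightarrow> \<omega> z = W z))"
proof -
  let ?S = "{z. 0 \<le> Im z}" and ?E = "{z. 0 \<le> Im z \<and> (\<exists>w. sub_point z w)}"
  have "connected ?S"
    using convex_halfspace_Im_ge[of 0] by (intro convex_connected) simp
  moreover have "openin (top_of_set ?S) ?E"
    unfolding openin_euclidean_subtopology_iff
  proof (intro conjI ballI)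
    fix z assume "z \<in> ?E"
    then obtain w where "0 \<le> Im z" "sub_point z w" by auto
    then obtain \<delta> \<omega> where "\<delta> > 0" "\<And>z'. z' \<in> ball z \<delta> \<Longrightarrow> sub_point z' (\<omega> z')"
      using sub_point_local_holomorphic by metis
    then show "\<exists>e>0. \<forall>x'\<in>?S. dist x' z < e \<longrightarrow> x' \<in> ?E"
      by (intro exI[of _ \<delta>]) (auto simp: dist_commute)
  qed auto
  moreover have "closedin (top_of_set ?S) ?E"
    by (rule closed_subset[OF _ closed_sub_points]) auto
  ultimately have "?E = ?S"
    unfolding connected_clopen using assms by blast
  then have ex: "\<exists>w. sub_point z w" if "0 \<le> Im z" for z using that by blast
  define \<omega> where "\<omega> z = (SOME w. sub_point z w)" for z
  have \<omega>: "sub_point z (\<omega> z)" if "0 \<le> Im z" for z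
    unfolding \<omega>_def by (rule someI_ex[OF ex[OF that]])
  show thesis
  proof (rule that[OF \<omega>])
    fix z0 assume z0: "0 \<le> Im z0"
    obtain \<delta> W where W: "\<delta> > 0" "W holomorphic_on ball z0 \<delta>" "\<And>z. z \<in> ball z0 \<delta> \<Longrightarrow> sub_point z (W z)"
      using sub_point_local_holomorphic[OF z0 \<omega>[OF z0]] by metis
    have "\<omega> z = W z" if "z \<in> ball z0 \<delta>" "0 \<le> Im z" for z
      using sub_point_unique[OF that(2) \<omega>[OF that(2)] W(3)[OF that(1)]] .
    then show "\<exists>\<delta>>0. \<exists>W. W holomorphic_on ball z0 \<delta> \<and>
       (\<forall>z\<in>ball z0 \<delta>. 0 < Im (W z) \<and> (0 \<le> Im z \<longrightarrow> \<omega> z = W z))"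
      using W by (intro exI[of _ \<delta>] exI[of _ W] conjI) (auto simp: sub_point_def)
  qed
qed

end

section \<open>Cauchy transforms\<close>

lemma borel_probD:
  assumes "borel_prob m"
  shows "prob_space m" "sets m = sets borel" "space m = UNIV"
  using assms sets_eq_imp_space_eq[of m borel] by (auto simp: borel_prob_def)

lemma borel_prob_measurable:
  assumes "borel_prob m" "f \<in> borel_measurable borel"
  shows "f \<in> borel_measurable m"
  unfolding measurable_cong_sets[OF borel_probD(2)[OF assms(1)] refl] by (rule assms(2))

lemma borel_prob_AE_eq_imp_return:
  assumes m: "borel_prob m" and ae: "AE t in m. t = a"
  shows "m = return borel a"
proof (rule measure_eqI)
  interpret prob_space m using borel_probD(1)[OF m] .
  show "sets m = sets (return borel a)" using borel_probD(2)[OF m] by simp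
  fix A assume A: "A \<in> sets m"
  have "emeasure m A = indicator A a"
  proof (cases "a \<in> A")
    case True
    then have "AE t in m. t \<in> A" using ae by auto
    then have "emeasure m A = emeasure m (space m)"
      using A by (intro emeasure_eq_AE) auto
    then have "emeasure m A = 1" by (simp only: emeasure_space_1)
    then show ?thesis using True by simp
  next
    case False
    then have "AE t in m. t \<notin> A" using ae by auto
    then have "emeasure m A = 0" using emeasure_eq_0_AE[where P = "\<lambda>t. t \<in> A" and M = m] A sets.sets_into_space[OF A]
      by (simp add: Int_absorb1 Collect_conj_eq)
    then show ?thesis using False by simp
  qed
  then show "emeasure m A = emeasure (return borel a) A"
    using A borel_probD(2)[OF m] by simp
qed

section \<open>The Cauchy kernel and holomorphy of its transform\<close>

lemma cauchy_kernel_norm_le: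
  assumes "0 < Im z"
  shows "cmod (1 / (z - complex_of_real t)) \<le> 1 / Im z" "z - complex_of_real t \<noteq> 0"
proof -
  have "Im z \<le> cmod (z - of_real t)" using abs_Im_le_cmod[of "z - of_real t"] by simp
  then show "cmod (1 / (z - complex_of_real t)) \<le> 1 / Im z"
    using assms by (simp add: norm_divide frac_le)
  show "z - complex_of_real t \<noteq> 0" using assms by auto
qed

lemma cauchy_kernel_measurable:
  assumes "0 < Im z"
  shows "(\<lambda>t. 1 / (z - complex_of_real t)) \<in> borel_measurable borel"
  by (intro borel_measurable_continuous_onI continuous_intros) (use cauchy_kernel_norm_le(2)[OF assms] in auto)

lemma cauchy_kernel_integrable:
  assumes "borel_prob m" "0 < Im z"
  shows "integrable m (\<lambda>t. 1 / (z - complex_of_real t))"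
proof -
  interpret prob_space m using borel_probD(1)[OF assms(1)] .
  show ?thesis
    by (rule integrable_const_bound[of _ "1 / Im z"])
       (use cauchy_kernel_norm_le[OF assms(2)]
          borel_prob_measurable[OF assms(1) cauchy_kernel_measurable[OF assms(2)]] in auto)
qed

lemma cauchy_G_holomorphic:
  assumes m: "borel_prob m"
  shows "cauchy_G m holomorphic_on uhp"
proof -
  interpret prob_space m using borel_probD(1)[OF m] .
  let ?K = "\<lambda>z t. 1 / (z - complex_of_real t)"
  have K1: "integrable m (?K z)" if "0 < Im z" for z
    using cauchy_kernel_integrable[OF m that] .
  have K2: "integrable m (\<lambda>t. (?K z t)\<^sup>2)" if "0 < Im z" for z
    by (rule integrable_const_bound[of _ "(1 / Im z)\<^sup>2"])
       (use cauchy_kernel_norm_le(1)[OF that] K1[OF that] in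
         \<open>auto simp: norm_power simp del: norm_divide_numeral intro!: power_mono\<close>)
  have "(cauchy_G m has_field_derivative - (\<integral>t. (?K z t)\<^sup>2 \<partial>m)) (at z)" if z: "0 < Im z" for z
  proof -
    let ?D = "- (\<integral>t. (?K z t)\<^sup>2 \<partial>m)"
    \<comment> \<open>The radius \<open>Im z / 2\<close> keeps \<open>Im y\<close> above
      \<open>Im z / 2\<close>, so the kernel at \<open>y\<close> is at most \<open>2 / Im z\<close>,
      uniformly in \<open>t\<close>.\<close>
    have bound: "cmod ((cauchy_G m y - cauchy_G m z) / (y - z) - ?D) \<le> 2 / Im z ^ 3 * cmod (y - z)"
      if y: "y \<noteq> z" "cmod (y - z) < Im z / 2" for y
    proof -
      have "Im z - Im y \<le> cmod (y - z)" using abs_Im_le_cmod[of "y - z"] by simp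
      then have Iy: "Im z / 2 < Im y" using y by simp
      then have Iy0: "0 < Im y" using z by simp
      \<comment> \<open>The resolvent identity is used twice: the first-order terms cancel and a
        factor \<open>y - z\<close> remains.\<close>
      have *: "(?K y t - ?K z t) / (y - z) + (?K z t)\<^sup>2 = (y - z) * (?K y t * (?K z t)\<^sup>2)" for t
      proof -
        have "?K z t - ?K y t = (y - z) * (?K y t * ?K z t)"
          using cauchy_kernel_norm_le(2)[OF z, of t] cauchy_kernel_norm_le(2)[OF Iy0, of t]
          by (simp add: field_simps)
        moreover have "(p - q) / d + q\<^sup>2 = d * (p * q\<^sup>2)" if "q - p = d * (p * q)" "d \<noteq> 0" for p q d :: complex
        proof -
          have "p - q = - (d * (p * q))" using that(1) by (simp add: algebra_simps)
          then have "(p - q) / d = - (p * q)" using that(2) by (simp del: minus_diff_eq)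
          then have "(p - q) / d + q\<^sup>2 = (q - p) * q" by (simp add: power2_eq_square algebra_simps)
          then show ?thesis unfolding that(1) by (simp add: power2_eq_square)
        qed
        ultimately show ?thesis using y(1) by simp
      qed
      have "(cauchy_G m y - cauchy_G m z) / (y - z) - ?D
          = (\<integral>t. (?K y t - ?K z t) / (y - z) + (?K z t)\<^sup>2 \<partial>m)"
        unfolding cauchy_G_def using K1[OF z] K1[OF Iy0] K2[OF z] by simp
      also have "\<dots> = (\<integral>t. (y - z) * (?K y t * (?K z t)\<^sup>2) \<partial>m)"
        unfolding * ..
      also have "cmod \<dots> \<le> (\<integral>t. cmod ((y - z) * (?K y t * (?K z t)\<^sup>2)) \<partial>m)"
        by (rule integral_norm_bound)
      also have "\<dots> \<le> 2 / Im z ^ 3 * cmod (y - z)"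
      proof (rule integral_le_const)
        show "integrable m (\<lambda>t. cmod ((y - z) * (?K y t * (?K z t)\<^sup>2)))"
          unfolding *[symmetric] using K1[OF z] K1[OF Iy0] K2[OF z] by simp
        show "AE t in m. cmod ((y - z) * (?K y t * (?K z t)\<^sup>2)) \<le> 2 / Im z ^ 3 * cmod (y - z)"
        proof (rule AE_I2)
          fix t
          have 1: "cmod (?K y t) \<le> 2 / Im z"
            using cauchy_kernel_norm_le(1)[OF Iy0, of t] Iy z frac_le[of 1 1 "Im z / 2" "Im y"] by simp
          have 2: "(cmod (?K z t))\<^sup>2 \<le> (1 / Im z)\<^sup>2"
            using cauchy_kernel_norm_le(1)[OF z, of t] by (intro power_mono) auto
          have "cmod (?K y t) * (cmod (?K z t))\<^sup>2 \<le> 2 / Im z * (1 / Im z)\<^sup>2"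
            using z by (intro mult_mono 1 2) auto
          also have "\<dots> = 2 / Im z ^ 3" by (simp add: power2_eq_square power3_eq_cube)
          finally have "cmod (y - z) * (cmod (?K y t) * (cmod (?K z t))\<^sup>2) \<le> cmod (y - z) * (2 / Im z ^ 3)"
            by (intro mult_left_mono) auto
          then show "cmod ((y - z) * (?K y t * (?K z t)\<^sup>2)) \<le> 2 / Im z ^ 3 * cmod (y - z)"
            unfolding norm_mult norm_power by (simp only: mult_ac)
        qed
      qed
      finally show ?thesis .
    qed
    have ev: "\<forall>\<^sub>F y in at z. cmod ((cauchy_G m y - cauchy_G m z) / (y - z) - ?D) \<le> 2 / Im z ^ 3 * cmod (y - z)"
      unfolding eventually_at by (rule exI[of _ "Im z / 2"]) (use z bound in \<open>auto simp: dist_norm\<close>)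
    have "((\<lambda>y. 2 / Im z ^ 3 * cmod (y - z)) \<longlongrightarrow> 2 / Im z ^ 3 * cmod (z - z)) (at z)"
      by (intro tendsto_intros)
    then have "((\<lambda>y. (cauchy_G m y - cauchy_G m z) / (y - z) - ?D) \<longlongrightarrow> 0) (at z)"
      by (intro Lim_null_comparison[OF ev]) simp
    then show ?thesis
      unfolding has_field_derivative_iff by (rule LIM_zero_cancel)
  qed
  then show ?thesis
    by (intro holomorphic_onI) (auto intro: has_field_derivative_at_within simp: field_differentiable_def)
qed

section \<open>Imaginary parts and nondegeneracy\<close>

lemma Im_cauchy_kernel:
  "Im (1 / (z - complex_of_real t)) = - (Im z * (cmod (1 / (z - complex_of_real t)))\<^sup>2)"
  by (simp add: Im_divide norm_divide power_divide cmod_power2)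

lemma cauchy_kernel_norm_power2_integrable:
  assumes m: "borel_prob m" and z: "0 < Im z"
  shows "integrable m (\<lambda>t. (cmod (1 / (z - complex_of_real t)))\<^sup>2)"
proof -
  interpret prob_space m using borel_probD(1)[OF m] .
  have [measurable]: "(\<lambda>t. 1 / (z - complex_of_real t)) \<in> borel_measurable m"
    using borel_prob_measurable[OF m] cauchy_kernel_measurable[OF z] by blast
  show ?thesis
  proof (rule integrable_const_bound[of _ "(1 / Im z)\<^sup>2"])
    show "AE t in m. norm ((cmod (1 / (z - complex_of_real t)))\<^sup>2) \<le> (1 / Im z)\<^sup>2"
      using cauchy_kernel_norm_le(1)[OF z] by (intro AE_I2) (simp only: real_norm_def abs_power2 power_mono norm_ge_zero)
  qed measurable
qed

lemma Im_cauchy_G: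
  assumes m: "borel_prob m" and z: "0 < Im z"
  shows "Im (cauchy_G m z) = - (Im z * (\<integral>t. (cmod (1 / (z - complex_of_real t)))\<^sup>2 \<partial>m))"
proof -
  have "Im (cauchy_G m z) = (\<integral>t. Im (1 / (z - complex_of_real t)) \<partial>m)"
    unfolding cauchy_G_def using cauchy_kernel_integrable[OF m z] by (rule integral_Im[symmetric])
  also have "\<dots> = - (Im z * (\<integral>t. (cmod (1 / (z - complex_of_real t)))\<^sup>2 \<partial>m))"
    unfolding Im_cauchy_kernel by simp
  finally show ?thesis .
qed

lemma Im_cauchy_G_neg:
  assumes m: "borel_prob m" and z: "0 < Im z"
  shows "Im (cauchy_G m z) < 0"
proof -
  interpret prob_space m using borel_probD(1)[OF m] .
  let ?f = "\<lambda>t. (cmod (1 / (z - complex_of_real t)))\<^sup>2"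
  have "(\<integral>t. ?f t \<partial>m) \<noteq> 0"
  proof
    assume "(\<integral>t. ?f t \<partial>m) = 0"
    then have "AE t in m. ?f t = 0"
      using cauchy_kernel_norm_power2_integrable[OF m z] by (subst (asm) integral_nonneg_eq_0_iff_AE) auto
    moreover have "?f t \<noteq> 0" for t using cauchy_kernel_norm_le(2)[OF z, of t] by simp
    ultimately have "AE t in m. False" by simp
    then show False by simp
  qed
  moreover have "0 \<le> (\<integral>t. ?f t \<partial>m)" by simp
  ultimately have "0 < (\<integral>t. ?f t \<partial>m)" by linarith
  then show ?thesis unfolding Im_cauchy_G[OF m z] using z by simp
qed

text \<open>With the kernel as a random variable X under \<open>m\<close> and
  \<open>cauchy_G m z\<close> as its mean, this is the formula E|X - EX|^2 = E|X|^2 -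
  |EX|^2.\<close>

lemma cauchy_kernel_variance:
  assumes m: "borel_prob m" and z: "0 < Im z"
  shows "integrable m (\<lambda>t. (cmod (1 / (z - complex_of_real t) - cauchy_G m z))\<^sup>2)"
    and "(\<integral>t. (cmod (1 / (z - complex_of_real t) - cauchy_G m z))\<^sup>2 \<partial>m)
      = (\<integral>t. (cmod (1 / (z - complex_of_real t)))\<^sup>2 \<partial>m) - (cmod (cauchy_G m z))\<^sup>2"
proof -
  interpret prob_space m using borel_probD(1)[OF m] .
  let ?X = "\<lambda>t. 1 / (z - complex_of_real t)" and ?c = "cauchy_G m z"
  have X: "integrable m ?X" using cauchy_kernel_integrable[OF m z] .
  have X2: "integrable m (\<lambda>t. (cmod (?X t))\<^sup>2)" using cauchy_kernel_norm_power2_integrable[OF m z] .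
  have eq: "(cmod (u - ?c))\<^sup>2 = (cmod u)\<^sup>2 - 2 * Re (u * cnj ?c) + (cmod ?c)\<^sup>2" for u
    unfolding cmod_power2 by (simp add: power2_eq_square algebra_simps)
  have Xc: "integrable m (\<lambda>t. Re (?X t * cnj ?c))"
    by (intro integrable_Re integrable_mult_left X)
  have "(\<integral>t. Re (?X t * cnj ?c) \<partial>m) = Re ((\<integral>t. ?X t * cnj ?c \<partial>m))"
    by (intro integral_Re integrable_mult_left X)
  also have "(\<integral>t. ?X t * cnj ?c \<partial>m) = (\<integral>t. ?X t \<partial>m) * cnj ?c"
    by (rule integral_mult_left_zero)
  also have "Re \<dots> = (cmod ?c)\<^sup>2"
    unfolding cauchy_G_def[symmetric] cmod_power2 by (simp add: power2_eq_square)
  finally have i: "(\<integral>t. Re (?X t * cnj ?c) \<partial>m) = (cmod ?c)\<^sup>2" .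
  show "integrable m (\<lambda>t. (cmod (?X t - ?c))\<^sup>2)"
    unfolding eq by (intro Bochner_Integration.integrable_add Bochner_Integration.integrable_diff X2 Xc integrable_mult_right) auto
  have "(\<integral>t. (cmod (?X t - ?c))\<^sup>2 \<partial>m) = (\<integral>t. (cmod (?X t))\<^sup>2 - 2 * Re (?X t * cnj ?c) + (cmod ?c)\<^sup>2 \<partial>m)"
    unfolding eq ..
  also have "\<dots> = (\<integral>t. (cmod (?X t))\<^sup>2 - 2 * Re (?X t * cnj ?c) \<partial>m) + (\<integral>t. (cmod ?c)\<^sup>2 \<partial>m)"
    by (intro Bochner_Integration.integral_add Bochner_Integration.integrable_diff X2 Xc integrable_mult_right) auto
  also have "(\<integral>t. (cmod (?X t))\<^sup>2 - 2 * Re (?X t * cnj ?c) \<partial>m)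
      = (\<integral>t. (cmod (?X t))\<^sup>2 \<partial>m) - (\<integral>t. 2 * Re (?X t * cnj ?c) \<partial>m)"
    by (intro Bochner_Integration.integral_diff X2 Xc integrable_mult_right)
  also have "(\<integral>t. 2 * Re (?X t * cnj ?c) \<partial>m) = 2 * (cmod ?c)\<^sup>2"
    unfolding integral_mult_right_zero i ..
  finally show "(\<integral>t. (cmod (?X t - ?c))\<^sup>2 \<partial>m) = (\<integral>t. (cmod (?X t))\<^sup>2 \<partial>m) - (cmod ?c)\<^sup>2"
    by (simp add: prob_space)
qed

text \<open>For the kernel X, the imaginary part of \<open>recip_F m z\<close> is
  \<open>Im z\<close> times E|X|^2 / |EX|^2, so its excess over \<open>Im z\<close> is governed by
  the variance of X. That vanishes only if X is almost surely constant, that is, if \<open>m\<close>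
  is a point mass.\<close>

lemma Im_h_fun_pos:
  assumes m: "borel_prob m" and nondeg: "\<nexists>a. m = return borel a" and z: "0 < Im z"
  shows "0 < Im (h_fun m z)"
proof -
  interpret prob_space m using borel_probD(1)[OF m] .
  let ?X = "\<lambda>t. 1 / (z - complex_of_real t)" and ?c = "cauchy_G m z"
  let ?S = "\<integral>t. (cmod (?X t))\<^sup>2 \<partial>m"
  have c0: "?c \<noteq> 0" using Im_cauchy_G_neg[OF m z] by auto
  have "(\<integral>t. (cmod (?X t - ?c))\<^sup>2 \<partial>m) \<noteq> 0"
  proof
    assume "(\<integral>t. (cmod (?X t - ?c))\<^sup>2 \<partial>m) = 0"
    then have "AE t in m. (cmod (?X t - ?c))\<^sup>2 = 0"
      using cauchy_kernel_variance(1)[OF m z] by (subst (asm) integral_nonneg_eq_0_iff_AE) auto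
    then have "AE t in m. t = Re (z - 1 / ?c)"
    proof (rule AE_mp, intro AE_I2 impI)
      fix t assume "(cmod (?X t - ?c))\<^sup>2 = 0"
      then have "?c = ?X t" by simp
      then have "of_real t = z - 1 / ?c" by simp
      then show "t = Re (z - 1 / ?c)" by (metis Re_complex_of_real)
    qed
    then show False using borel_prob_AE_eq_imp_return[OF m] nondeg by blast
  qed
  moreover have "0 \<le> (\<integral>t. (cmod (?X t - ?c))\<^sup>2 \<partial>m)" by simp
  ultimately have "(cmod ?c)\<^sup>2 < ?S" using cauchy_kernel_variance(2)[OF m z] by linarith
  then have "1 < ?S / (cmod ?c)\<^sup>2" using c0 by simp
  then have "Im z * 1 < Im z * (?S / (cmod ?c)\<^sup>2)" using z by (intro mult_strict_left_mono)
  moreover have "Im (1 / ?c) = Im z * (?S / (cmod ?c)\<^sup>2)"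
    using Im_cauchy_G[OF m z] by (simp add: Im_divide cmod_power2)
  ultimately show ?thesis by (simp add: h_fun_def recip_F_def)
qed

lemma h_fun_holomorphic:
  assumes "borel_prob m"
  shows "h_fun m holomorphic_on uhp"
  unfolding h_fun_def recip_F_def
  by (intro holomorphic_intros cauchy_G_holomorphic assms) (use Im_cauchy_G_neg[OF assms] in force)

text \<open>The hypothesis on limits excludes a real constant, so this shows that
  \<open>\<mu>\<close> cannot be a point mass.\<close>

lemma h_fun_return:
  assumes "0 < Im z"
  shows "h_fun (return borel a) z = - of_real a"
proof -
  have "cauchy_G (return borel a) z = 1 / (z - of_real a)"
    unfolding cauchy_G_def by (rule integral_return) (use cauchy_kernel_measurable[OF assms] in auto)
  then show ?thesis by (simp add: h_fun_def recip_F_def)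
qed

section \<open>Stieltjes inversion\<close>

lemma arctan_scaled_limit: "(\<lambda>n. arctan (c * real (Suc n))) \<longlonglongrightarrow> pi / 2 * sgn c"
proof -
  have s: "filterlim (\<lambda>n. real (Suc n)) at_top sequentially"
    using filterlim_compose[OF filterlim_real_sequentially filterlim_Suc] .
  consider "c = 0" | "c > 0" | "c < 0" by linarith
  then show ?thesis
  proof cases
    case 2
    then have "filterlim (\<lambda>n. c * real (Suc n)) at_top sequentially"
      by (intro filterlim_tendsto_pos_mult_at_top[OF tendsto_const _ s])
    then show ?thesis using 2 filterlim_compose[OF tendsto_arctan_at_top] by fastforce
  next
    case 3
    then have "filterlim (\<lambda>n. c * real (Suc n)) at_bot sequentially"
      by (intro filterlim_tendsto_neg_mult_at_bot[OF tendsto_const _ s])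
    then show ?thesis using 3 filterlim_compose[OF tendsto_arctan_at_bot] by fastforce
  qed simp
qed

lemma arctan_scaled_has_derivative:
  assumes "y > 0"
  shows "((\<lambda>t. arctan ((t - s) / y) / pi) has_real_derivative y / ((t - s)\<^sup>2 + y\<^sup>2) / pi) (at t)"
proof -
  have "(t - s)\<^sup>2 + y\<^sup>2 \<noteq> 0" using assms by (simp add: sum_power2_eq_zero_iff)
  then have "inverse (1 + ((t - s) / y)\<^sup>2) * (1 / y) = y / ((t - s)\<^sup>2 + y\<^sup>2)"
    using assms by (simp add: power_divide field_simps power2_eq_square)
  moreover have "((\<lambda>t. arctan ((t - s) / y) / pi) has_real_derivative
      inverse (1 + ((t - s) / y)\<^sup>2) * (1 / y) / pi) (at t)"
    using assms by (auto intro!: derivative_eq_intros)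
  ultimately show ?thesis by simp
qed

text \<open>On a horizontal line the integrand on the left is the Poisson smoothing of
  \<open>m\<close>. Tonelli's theorem and the arctangent antiderivative give its mass on an
  interval.\<close>

lemma nn_integral_poisson:
  assumes m: "borel_prob m" and y: "y > 0" and ab: "a \<le> b"
  shows "(\<integral>\<^sup>+t. ennreal (- Im (cauchy_G m (Complex t y)) / pi) * indicator {a..b} t \<partial>lborel)
    = (\<integral>\<^sup>+s. ennreal (arctan ((b - s) / y) / pi - arctan ((a - s) / y) / pi) \<partial>m)"
proof -
  interpret m: prob_space m using borel_probD(1)[OF m] .
  interpret pair_sigma_finite m lborel ..
  have sm[measurable_cong]: "sets m = sets borel" using borel_probD(2)[OF m] .
  let ?p = "\<lambda>s t. y / ((t - s)\<^sup>2 + y\<^sup>2) / pi"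
  have nn: "0 \<le> ?p s t" for s t using y by (intro divide_nonneg_nonneg) auto
  have "ennreal (- Im (cauchy_G m (Complex t y)) / pi) = (\<integral>\<^sup>+s. ennreal (?p s t) \<partial>m)" for t
  proof -
    have z: "0 < Im (Complex t y)" using y by simp
    have p: "?p s t = - Im (1 / (Complex t y - of_real s)) / pi" for s
      by (simp add: Im_divide)
    have int: "integrable m (\<lambda>s. ?p s t)"
      unfolding p by (intro integrable_divide integrable_minus integrable_Im cauchy_kernel_integrable[OF m z])
    have "- Im (cauchy_G m (Complex t y)) / pi = (\<integral>s. ?p s t \<partial>m)"
      unfolding p cauchy_G_def integral_Im[OF cauchy_kernel_integrable[OF m z], symmetric] by simp
    then show ?thesis using nn_integral_eq_integral[OF int] nn by simp
  qed
  then have "(\<integral>\<^sup>+t. ennreal (- Im (cauchy_G m (Complex t y)) / pi) * indicator {a..b} t \<partial>lborel)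
      = (\<integral>\<^sup>+t. (\<integral>\<^sup>+s. ennreal (?p s t) * indicator {a..b} t \<partial>m) \<partial>lborel)"
    by (simp add: nn_integral_multc)
  also have "\<dots> = (\<integral>\<^sup>+s. (\<integral>\<^sup>+t. ennreal (?p s t) * indicator {a..b} t \<partial>lborel) \<partial>m)"
    by (rule Fubini') measurable
  also have "\<dots> = (\<integral>\<^sup>+s. ennreal (arctan ((b - s) / y) / pi - arctan ((a - s) / y) / pi) \<partial>m)"
    by (intro nn_integral_cong nn_integral_FTC_Icc)
       (use nn ab arctan_scaled_has_derivative[OF y] in auto)
  finally show ?thesis .
qed

text \<open>The height tends to 0 in \<open>nn_integral_poisson\<close>. On the left
  \<open>g\<close> is bounded on a compact rectangle; on the right the arctangents become signs,
  with weight 1 inside the interval, 0 outside and, for \<open>a < b\<close>, 1/2 at the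
  endpoints.\<close>

lemma nn_integral_boundary_values:
  assumes m: "borel_prob m" and ab: "a \<le> b"
    and cont: "continuous_on {z. 0 \<le> Im z} g"
    and g: "\<And>z. 0 < Im z \<Longrightarrow> g z = cauchy_G m z"
  shows "(\<integral>\<^sup>+t. ennreal (- Im (g (of_real t)) / pi) * indicator {a..b} t \<partial>lborel)
    = (\<integral>\<^sup>+s. ennreal ((sgn (b - s) - sgn (a - s)) / 2) \<partial>m)"
proof -
  interpret m: prob_space m using borel_probD(1)[OF m] .
  have sm[measurable_cong]: "sets m = sets borel" using borel_probD(2)[OF m] .
  define y where "y = (\<lambda>n. 1 / real (Suc n))"
  have y: "0 < y n" "y n \<le> 1" for n by (auto simp: y_def)
  have y0: "y \<longlonglongrightarrow> 0" unfolding y_def by real_asymp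
  let ?K = "{w. Re w \<in> {a..b} \<and> Im w \<in> {0..1}}"
  have K: "?K = cbox (Complex a 0) (Complex b 1)" by (auto simp: in_cbox_complex_iff)
  have "compact ?K" unfolding K by (rule compact_cbox)
  then have "compact (g ` ?K)"
    by (intro compact_continuous_image continuous_on_subset[OF cont]) auto
  then obtain B where B: "\<And>w. w \<in> ?K \<Longrightarrow> cmod (g w) \<le> B"
    using compact_imp_bounded bounded_iff by (metis (no_types, lifting) imageI)
  have meas: "(\<lambda>t. g (Complex t v)) \<in> borel_measurable borel" if "0 \<le> v" for v
    by (intro borel_measurable_continuous_onI continuous_on_compose2[OF cont])
       (use that in \<open>auto simp: Complex_eq intro!: continuous_intros\<close>)
  have [measurable]: "(\<lambda>t. g (Complex t (y n))) \<in> borel_measurable borel" for n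
    by (rule meas) (use y[of n] in auto)
  have [measurable]: "(\<lambda>t. g (of_real t)) \<in> borel_measurable borel"
    using meas[of 0] by (simp add: complex_of_real_def)
  let ?L = "\<lambda>n. (\<integral>\<^sup>+t. ennreal (- Im (g (Complex t (y n))) / pi) * indicator {a..b} t \<partial>lborel)"
  have lim: "?L \<longlonglongrightarrow> (\<integral>\<^sup>+t. ennreal (- Im (g (of_real t)) / pi) * indicator {a..b} t \<partial>lborel)"
  proof (rule nn_integral_dominated_convergence[where w = "\<lambda>t. ennreal (B / pi) * indicator {a..b} t"])
    show "(\<integral>\<^sup>+t. ennreal (B / pi) * indicator {a..b} t \<partial>lborel) < \<infinity>"
      using ab by (subst nn_integral_cmult_indicator) (auto simp: ennreal_mult_less_top)
    show "AE t in lborel. ennreal (- Im (g (Complex t (y n))) / pi) * indicator {a..b} t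
        \<le> ennreal (B / pi) * indicator {a..b} t" for n
    proof (intro AE_I2)
      fix t
      show "ennreal (- Im (g (Complex t (y n))) / pi) * indicator {a..b} t \<le> ennreal (B / pi) * indicator {a..b} t"
      proof (cases "t \<in> {a..b}")
        case True
        then have "cmod (g (Complex t (y n))) \<le> B" using B[of "Complex t (y n)"] y[of n] by auto
        then have "- Im (g (Complex t (y n))) \<le> B" using abs_Im_le_cmod[of "g (Complex t (y n))"] by linarith
        then have "- Im (g (Complex t (y n))) / pi \<le> B / pi" by (intro divide_right_mono) auto
        then show ?thesis using True by (simp add: ennreal_leI)
      qed auto
    qed
    show "AE t in lborel. (\<lambda>n. ennreal (- Im (g (Complex t (y n))) / pi) * indicator {a..b} t) \<longlonglongrightarrow>
        ennreal (- Im (g (of_real t)) / pi) * indicator {a..b} t"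
    proof (intro AE_I2)
      fix t :: real
      have "(\<lambda>n. g (Complex t (y n))) \<longlonglongrightarrow> g (Complex t 0)"
      proof (rule continuous_on_tendsto_compose[OF cont])
        show "(\<lambda>n. Complex t (y n)) \<longlonglongrightarrow> Complex t 0" by (intro tendsto_intros y0)
      qed (use y(1) in \<open>auto intro!: always_eventually less_imp_le\<close>)
      then have "(\<lambda>n. g (Complex t (y n))) \<longlonglongrightarrow> g (of_real t)" by (simp add: complex_of_real_def)
      then have "(\<lambda>n. ennreal (- Im (g (Complex t (y n))) / pi)) \<longlonglongrightarrow> ennreal (- Im (g (of_real t)) / pi)"
        by (intro tendsto_intros tendsto_ennrealI) auto
      then show "(\<lambda>n. ennreal (- Im (g (Complex t (y n))) / pi) * indicator {a..b} t) \<longlonglongrightarrow>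
        ennreal (- Im (g (of_real t)) / pi) * indicator {a..b} t"
        by (cases "t \<in> {a..b}") auto
    qed
  qed auto
  have eq: "?L = (\<lambda>n. (\<integral>\<^sup>+s. ennreal (arctan ((b - s) / y n) / pi - arctan ((a - s) / y n) / pi) \<partial>m))"
  proof
    fix n
    show "?L n = (\<integral>\<^sup>+s. ennreal (arctan ((b - s) / y n) / pi - arctan ((a - s) / y n) / pi) \<partial>m)"
      using nn_integral_poisson[OF m y(1) ab, of n] y(1)[of n] by (simp add: g)
  qed
  have "(\<lambda>n. (\<integral>\<^sup>+s. ennreal (arctan ((b - s) / y n) / pi - arctan ((a - s) / y n) / pi) \<partial>m))
     \<longlonglongrightarrow> (\<integral>\<^sup>+s. ennreal ((sgn (b - s) - sgn (a - s)) / 2) \<partial>m)"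
  proof (rule nn_integral_dominated_convergence[where w = "\<lambda>_. 1"])
    show "AE s in m. ennreal (arctan ((b - s) / y n) / pi - arctan ((a - s) / y n) / pi) \<le> 1" for n
    proof (intro AE_I2)
      fix s
      have "arctan ((b - s) / y n) / pi - arctan ((a - s) / y n) / pi \<le> 1"
        using arctan_ubound[of "(b - s) / y n"] arctan_lbound[of "(a - s) / y n"]
        by (simp add: diff_divide_distrib[symmetric])
      then show "ennreal (arctan ((b - s) / y n) / pi - arctan ((a - s) / y n) / pi) \<le> 1"
        using ennreal_leI by fastforce
    qed
    show "AE s in m. (\<lambda>n. ennreal (arctan ((b - s) / y n) / pi - arctan ((a - s) / y n) / pi))
      \<longlonglongrightarrow> ennreal ((sgn (b - s) - sgn (a - s)) / 2)"
    proof (intro AE_I2 tendsto_ennrealI)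
      fix s
      have "(\<lambda>n. arctan ((b - s) * real (Suc n)) / pi - arctan ((a - s) * real (Suc n)) / pi)
         \<longlonglongrightarrow> pi / 2 * sgn (b - s) / pi - pi / 2 * sgn (a - s) / pi"
        by (intro tendsto_intros arctan_scaled_limit) auto
      then show "(\<lambda>n. arctan ((b - s) / y n) / pi - arctan ((a - s) / y n) / pi)
         \<longlonglongrightarrow> (sgn (b - s) - sgn (a - s)) / 2"
        by (simp add: y_def diff_divide_distrib)
    qed
    show "(\<integral>\<^sup>+s. 1 \<partial>m) < \<infinity>" by (simp add: m.emeasure_space_1)
  qed auto
  then show ?thesis unfolding eq[symmetric] by (rule LIMSEQ_unique[OF lim])
qed

text \<open>The sign integral is squeezed between the \<open>m\<close>-masses of the open and the
  closed interval, so the two measures agree up to endpoints. The density has no atoms, and the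
  squeeze transfers this to \<open>m\<close>.\<close>

lemma stieltjes_inversion:
  assumes m: "borel_prob m"
    and cont: "continuous_on {z. 0 \<le> Im z} g"
    and g: "\<And>z. 0 < Im z \<Longrightarrow> g z = cauchy_G m z"
  shows "m = density lborel (\<lambda>t. ennreal (- Im (g (of_real t)) / pi))" (is "m = ?N")
proof -
  interpret m: prob_space m using borel_probD(1)[OF m] .
  have sm[measurable_cong]: "sets m = sets borel" using borel_probD(2)[OF m] .
  have "(\<lambda>t::real. g (of_real t)) \<in> borel_measurable borel"
    by (intro borel_measurable_continuous_onI continuous_on_compose2[OF cont]) (auto intro!: continuous_intros)
  then have fm: "(\<lambda>t. ennreal (- Im (g (of_real t)) / pi)) \<in> borel_measurable lborel"
    by measurable
  have N: "emeasure ?N {a..b} = (\<integral>\<^sup>+s. ennreal ((sgn (b - s) - sgn (a - s)) / 2) \<partial>m)" if "a \<le> b" for a b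
  proof -
    have "emeasure ?N {a..b} = (\<integral>\<^sup>+t. ennreal (- Im (g (of_real t)) / pi) * indicator {a..b} t \<partial>lborel)"
      by (rule emeasure_density[OF fm]) simp
    also have "\<dots> = (\<integral>\<^sup>+s. ennreal ((sgn (b - s) - sgn (a - s)) / 2) \<partial>m)"
      by (rule nn_integral_boundary_values[OF m that cont g])
    finally show ?thesis .
  qed
  have le1: "emeasure m {a<..<b} \<le> emeasure ?N {a..b}" if ab: "a \<le> b" for a b
  proof -
    have "emeasure m {a<..<b} = (\<integral>\<^sup>+s. indicator {a<..<b} s \<partial>m)" by simp
    also have "\<dots> \<le> emeasure ?N {a..b}"
      unfolding N[OF ab] by (intro nn_integral_mono) (auto simp: indicator_def)
    finally show ?thesis .
  qed
  have le2: "emeasure ?N {a..b} \<le> emeasure m {a..b}" if ab: "a \<le> b" for a b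
  proof -
    have "emeasure ?N {a..b} \<le> (\<integral>\<^sup>+s. indicator {a..b} s \<partial>m)"
      unfolding N[OF ab] using ab
      by (intro nn_integral_mono) (auto simp: indicator_def sgn_if ennreal_leI[of "1/2" 1, simplified])
    also have "\<dots> = emeasure m {a..b}" by simp
    finally show ?thesis .
  qed
  have atomN: "emeasure ?N {c} = 0" for c
  proof -
    have "{c} \<in> null_sets ?N"
      by (rule absolutely_continuousI_density[OF fm, unfolded absolutely_continuous_def, THEN subsetD])
         (simp add: null_sets_def)
    then show ?thesis by auto
  qed
  \<comment> \<open>Open intervals around \<open>c\<close> have \<open>m\<close>-mass at most the
    \<open>?N\<close>-mass of their closures. The latter is finite by \<open>le2\<close> and
    decreases to the \<open>?N\<close>-mass of \<open>{c}\<close>, which is 0.\<close>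
  have atom: "emeasure m {c} = 0" for c
  proof -
    let ?A = "\<lambda>n. {c - 1 / real (Suc n)..c + 1 / real (Suc n)}"
    have "(\<lambda>n. emeasure ?N (?A n)) \<longlonglongrightarrow> emeasure ?N (\<Inter>n. ?A n)"
    proof (rule Lim_emeasure_decseq)
      show "decseq ?A"
        by (intro decseq_SucI) (auto simp: field_simps intro: order_trans)
      show "emeasure ?N (?A n) \<noteq> \<infinity>" for n
      proof -
        have "emeasure ?N (?A n) \<le> emeasure m (?A n)" by (rule le2) simp
        also have "\<dots> < top" unfolding m.emeasure_eq_measure by simp
        finally show ?thesis by simp
      qed
    qed auto
    moreover have "(\<Inter>n. ?A n) = {c}"
    proof (intro equalityI subsetI)
      fix x assume x: "x \<in> (\<Inter>n. ?A n)"
      have "x = c"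
      proof (rule ccontr)
        assume "x \<noteq> c"
        then obtain n where n: "inverse (real (Suc n)) < \<bar>x - c\<bar>"
          using reals_Archimedean[of "\<bar>x - c\<bar>"] by auto
        have "x \<in> ?A n" using x by blast
        then have "\<bar>x - c\<bar> \<le> inverse (real (Suc n))" unfolding inverse_eq_divide by (simp add: abs_le_iff algebra_simps)
        with n show False by simp
      qed
      then show "x \<in> {c}" by simp
    qed auto
    ultimately have lim: "(\<lambda>n. emeasure ?N (?A n)) \<longlonglongrightarrow> 0" using atomN by simp
    have "emeasure m {c} \<le> emeasure ?N (?A n)" for n
    proof -
      have "emeasure m {c} \<le> emeasure m {c - 1 / real (Suc n)<..<c + 1 / real (Suc n)}"
        by (intro emeasure_mono) (auto simp: sm)
      also have "\<dots> \<le> emeasure ?N (?A n)" by (rule le1) simp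
      finally show ?thesis .
    qed
    then have "emeasure m {c} \<le> 0" by (intro LIMSEQ_le_const[OF lim]) auto
    then show ?thesis by simp
  qed
  show ?thesis
  \<comment> \<open>Half-open intervals form an intersection-stable generator and differ from closed
    ones by an endpoint, null for both measures.\<close>
  proof (rule measure_eqI_generator_eq[where \<Omega> = UNIV])
    fix X assume "X \<in> range (\<lambda>(a, b). {a<..b::real})"
    then obtain a b where X: "X = {a<..b}" by auto
    show "emeasure m X = emeasure ?N X"
    proof (cases "a \<le> b")
      case True
      have drop: "emeasure M (A - S) = emeasure M A"
        if "finite S" "\<And>c. emeasure M {c} = 0" "sets M = sets borel" "A \<in> sets borel" for M and A S :: "real set"
      proof -
        have "S \<in> null_sets M"
        proof -
          have "(\<Union>c\<in>S. {c}) \<in> null_sets M"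
            using that by (intro null_sets_UN') (auto simp: null_sets_def countable_finite)
          then show ?thesis by simp
        qed
        then show ?thesis using that by (intro emeasure_Diff_null_set) auto
      qed
      have X': "X = {a..b} - {a}" "{a<..<b} = {a..b} - {a, b}" using X by auto
      have "emeasure m {a<..<b} = emeasure m {a..b}"
        unfolding X' by (rule drop) (auto simp: atom sm)
      then have "emeasure m {a..b} = emeasure ?N {a..b}"
        using le1[OF True] le2[OF True] by auto
      moreover have "emeasure m X = emeasure m {a..b}"
        unfolding X' by (rule drop[OF _ atom]) (simp_all add: sm)
      moreover have "emeasure ?N X = emeasure ?N {a..b}"
        unfolding X' by (rule drop[OF _ atomN]) simp_all
      ultimately show ?thesis by simp
    qed (simp add: X)
  next
    show "(\<Union>i. {- real (i::nat)<..real i}) = UNIV" by (rule UN_Ioc_eq_UNIV)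
  qed (auto simp: sm borel_sigma_sets_Ioc Int_stable_def m.emeasure_eq_measure)
qed

section \<open>Free convolution\<close>

lemma inf_cone_uhp:
  assumes "\<alpha> > 0" "z \<in> inf_cone \<alpha> M"
  shows "0 < Im z"
proof -
  have "0 \<le> \<alpha> * \<bar>Re z\<bar>" using assms(1) by simp
  also have "\<dots> < Im z" using assms(2) by (simp add: inf_cone_def)
  finally show ?thesis .
qed

lemma uncountable_inf_cone:
  assumes "M > 0"
  shows "uncountable (inf_cone \<alpha> M)"
proof -
  have "uncountable {M<..<M + 1}" by (simp add: uncountable_open_interval)
  moreover have "inj_on (\<lambda>t. \<i> * of_real t) {M<..<M + 1}" by (auto simp: inj_on_def)
  ultimately have "uncountable ((\<lambda>t. \<i> * of_real t) ` {M<..<M + 1})"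
    using countable_image_inj_on by blast
  moreover have "(\<lambda>t. \<i> * of_real t) ` {M<..<M + 1} \<subseteq> inf_cone \<alpha> M"
    using assms by (auto simp: inf_cone_def norm_mult)
  ultimately show ?thesis using countable_subset by blast
qed

text \<open>A side condition of the identity theorem for uncountable coincidence sets,
  \<open>holomorphic_countable_equal\<close>.\<close>

lemma fsigma_uhp: "fsigma uhp"
proof -
  have "uhp = (\<Union>n. {z. inverse (real (Suc n)) \<le> Im z})"
  proof (intro equalityI subsetI)
    fix z assume "z \<in> uhp"
    then obtain n where "inverse (real (Suc n)) < Im z" using reals_Archimedean by auto
    then show "z \<in> (\<Union>n. {z. inverse (real (Suc n)) \<le> Im z})" by (auto intro: less_imp_le)
  next
    fix z assume "z \<in> (\<Union>n. {z. inverse (real (Suc n)) \<le> Im z})"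
    then obtain n where "inverse (real (Suc n)) \<le> Im z" by auto
    moreover have "0 < inverse (real (Suc n))" by simp
    ultimately show "z \<in> uhp" by (simp del: inverse_positive_iff_positive)
  qed
  moreover have "fsigma (\<Union>n. {z. inverse (real (Suc n)) \<le> Im z})"
    by (intro fsigma.intros closed_halfspace_Im_ge[simplified]) 
  ultimately show ?thesis by simp
qed

text \<open>For \<open>\<zeta>\<close> in the cone let \<open>w\<close>, \<open>u\<close>,
  \<open>z\<close> be the preimages under the reciprocal transforms of \<open>\<mu>\<close>,
  \<open>\<nu>\<close>, \<open>\<rho>\<close>. Additivity reads \<open>z = w + u - \<zeta>\<close>,
  whence \<open>z + h_fun \<mu> w = u\<close> and \<open>z + h_fun \<nu> u = w\<close>. Uncountably
  many such \<open>z\<close> suffice for the identity theorem.\<close>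

lemma free_conv_subordinate:
  assumes "free_conv \<mu> \<nu> \<rho>"
  obtains Z where "uncountable Z"
    "\<And>z. z \<in> Z \<Longrightarrow> 0 < Im z \<and> (\<exists>w. 0 < Im w \<and> z + h_fun \<nu> (z + h_fun \<mu> w) = w \<and>
       recip_F \<rho> z = recip_F \<mu> w)"
proof -
  obtain \<alpha> M \<phi>1 \<phi>2 \<phi>3 where c: "\<alpha> > 0" "M > 0" "voiculescu_on \<mu> \<alpha> M \<phi>1" "voiculescu_on \<nu> \<alpha> M \<phi>2"
      "voiculescu_on \<rho> \<alpha> M \<phi>3" "\<And>z. z \<in> inf_cone \<alpha> M \<Longrightarrow> \<phi>3 z = \<phi>1 z + \<phi>2 z"
    using assms unfolding free_conv_def by blast
  have inv: "0 < Im (\<zeta> + \<phi> \<zeta>)" "recip_F m (\<zeta> + \<phi> \<zeta>) = \<zeta>"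
    if v: "voiculescu_on m \<alpha> M \<phi>" and \<zeta>: "\<zeta> \<in> inf_cone \<alpha> M" for m \<phi> \<zeta>
  proof -
    obtain \<alpha>' M' where a: "\<alpha>' > 0" "inf_cone \<alpha> M \<subseteq> recip_F m ` inf_cone \<alpha>' M'"
        "\<forall>z\<in>inf_cone \<alpha> M. \<phi> z = inv_into (inf_cone \<alpha>' M') (recip_F m) z - z"
      using v unfolding voiculescu_on_def by blast
    have e: "\<zeta> + \<phi> \<zeta> = inv_into (inf_cone \<alpha>' M') (recip_F m) \<zeta>" using a(3) \<zeta> by simp
    have im: "\<zeta> \<in> recip_F m ` inf_cone \<alpha>' M'" using a(2) \<zeta> by blast
    show "0 < Im (\<zeta> + \<phi> \<zeta>)" unfolding e using inv_into_into[OF im] inf_cone_uhp[OF a(1)] by blast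
    show "recip_F m (\<zeta> + \<phi> \<zeta>) = \<zeta>" unfolding e using f_inv_into_f[OF im] .
  qed
  let ?Z = "(\<lambda>\<zeta>. \<zeta> + \<phi>3 \<zeta>) ` inf_cone \<alpha> M"
  \<comment> \<open>Mapping \<open>?Z\<close> onto the uncountable cone shows that \<open>?Z\<close>
    is uncountable.\<close>
  have "recip_F \<rho> ` ?Z = inf_cone \<alpha> M"
    using inv(2)[OF c(5)] by (force simp: image_image)
  then have "uncountable ?Z"
    using uncountable_inf_cone[OF c(2), of \<alpha>] countable_image[of ?Z "recip_F \<rho>"] by metis
  then show thesis
  proof (rule that)
    fix z assume "z \<in> ?Z"
    then obtain \<zeta> where \<zeta>: "\<zeta> \<in> inf_cone \<alpha> M" "z = \<zeta> + \<phi>3 \<zeta>" by auto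
    define w u where "w = \<zeta> + \<phi>1 \<zeta>" and "u = \<zeta> + \<phi>2 \<zeta>"
    have F: "recip_F \<mu> w = \<zeta>" "recip_F \<nu> u = \<zeta>" "recip_F \<rho> z = \<zeta>" "0 < Im z" "0 < Im w"
      unfolding w_def u_def \<zeta>(2) using inv \<zeta>(1) c(3-5) by auto
    have zwu: "z = w + u - \<zeta>" unfolding w_def u_def \<zeta>(2) c(6)[OF \<zeta>(1)] by simp
    have "z + h_fun \<mu> w = u" unfolding h_fun_def F zwu by simp
    moreover have "z + h_fun \<nu> u = w" unfolding h_fun_def F zwu by simp
    ultimately have "z + h_fun \<nu> (z + h_fun \<mu> w) = w" by simp
    then show "0 < Im z \<and> (\<exists>w. 0 < Im w \<and> z + h_fun \<nu> (z + h_fun \<mu> w) = w \<and>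
       recip_F \<rho> z = recip_F \<mu> w)"
      using F by auto
  qed
qed

text \<open>At a real centre the powers \<open>(y - x) ^ n\<close> are real, so the imaginary part
  can be taken coefficient by coefficient in the Taylor series.\<close>

lemma real_analytic_Im:
  assumes "\<And>x::real. \<exists>\<delta>>0. \<exists>A. A holomorphic_on ball (of_real x) \<delta> \<and>
      (\<forall>t. \<bar>t - x\<bar> < \<delta> \<longrightarrow> f t = c * Im (A (of_real t)))"
  shows "real_analytic_on UNIV f"
  unfolding real_analytic_on_def
proof
  fix x :: real
  obtain \<delta> A where A: "\<delta> > 0" "A holomorphic_on ball (of_real x) \<delta>"
      "\<And>t. \<bar>t - x\<bar> < \<delta> \<Longrightarrow> f t = c * Im (A (of_real t))"
    using assms[of x] by blast
  define a where "a n = c * Im ((deriv ^^ n) A (of_real x) / fact n)" for n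
  have "(\<lambda>n. a n * (y - x) ^ n) sums f y" if y: "\<bar>y - x\<bar> < \<delta>" for y
  proof -
    have "dist (complex_of_real x) (of_real y) = \<bar>y - x\<bar>"
      by (simp add: dist_norm norm_minus_commute flip: of_real_diff)
    then have "complex_of_real y \<in> ball (of_real x) \<delta>" using y by simp
    from sums_mult[OF sums_Im[OF holomorphic_power_series[OF A(2) this]], of c]
    have "(\<lambda>n. c * Im ((deriv ^^ n) A (of_real x) / fact n * (of_real y - of_real x) ^ n)) sums (c * Im (A (of_real y)))" .
    moreover have "c * Im ((deriv ^^ n) A (of_real x) / fact n * (of_real y - of_real x) ^ n) = a n * (y - x) ^ n" for n
      unfolding a_def of_real_diff[symmetric] of_real_power[symmetric]
      by (simp only: times_complex.sel Re_complex_of_real Im_complex_of_real mult_zero_right add_0 mult.assoc)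
    ultimately show ?thesis using A(3)[OF y] by simp
  qed
  then show "\<exists>r>0. \<exists>a. \<forall>y. \<bar>y - x\<bar> < r \<longrightarrow> (\<lambda>n. a n * (y - x) ^ n) sums f y"
    using A(1) by blast
qed

text \<open>Limits are understood in the Riemann sphere: an infinite nontangential limit exists and
  lies outside the upper half-plane, so separate clauses exclude it. Free convolution is a relation,
  and the claim covers every \<open>\<rho>\<close> it admits.\<close>

theorem mainTheorem2:
  fixes \<mu> :: "real measure"
  assumes "borel_prob \<mu>"
    and "\<forall>x::real. (\<forall>L. nt_lim (h_fun \<mu>) x L \<longrightarrow> Im L > 0) \<and> \<not> nt_lim_infty_val (h_fun \<mu>) x"
    and "(\<forall>L. nt_lim_at_inf (h_fun \<mu>) L \<longrightarrow> Im L > 0) \<and> \<not> nt_lim_at_inf_infty_val (h_fun \<mu>)"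
  shows "\<forall>\<nu> \<rho>. borel_prob \<nu> \<and> \<not> (\<exists>a. \<nu> = return borel a) \<and> free_conv \<mu> \<nu> \<rho> \<longrightarrow>
           absolutely_continuous lborel \<rho> \<and>
           (\<exists>f::real \<Rightarrow> real. (\<forall>x. f x > 0) \<and> real_analytic_on UNIV f \<and>
               \<rho> = density lborel (\<lambda>x. ennreal (f x)))"
proof (intro allI impI, elim conjE)
  fix \<nu> \<rho>
  assume \<nu>: "borel_prob \<nu>" "\<not> (\<exists>a. \<nu> = return borel a)" and conv: "free_conv \<mu> \<nu> \<rho>"
  have \<rho>: "borel_prob \<rho>" using conv by (simp add: free_conv_def)
  have \<mu>_nondeg: "\<nexists>a. \<mu> = return borel a"
  proof
    assume "\<exists>a. \<mu> = return borel a"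
    then obtain a where a: "\<mu> = return borel a" by blast
    have "nt_lim (h_fun \<mu>) 0 (- of_real a)"
      unfolding nt_lim_def
    proof (intro allI impI tendsto_eventually)
      fix c :: real
      show "\<forall>\<^sub>F z in at (complex_of_real 0) within nt_cone 0 c. h_fun \<mu> z = - of_real a"
        unfolding eventually_at_filter a by (intro always_eventually) (auto simp: nt_cone_def h_fun_return)
    qed
    then show False using assms(2) by fastforce
  qed
  interpret subordination "h_fun \<mu>" "h_fun \<nu>"
  proof
    show "\<exists>B. \<forall>w. 0 < Im w \<and> pick_dist w \<i> \<le> C * pick_dist (h_fun \<mu> w) \<i> \<longrightarrow> pick_dist w \<i> \<le> B" for C
      by (rule pick_dist_bounded_if_no_boundary_limit[OF h_fun_holomorphic[OF assms(1)] Im_h_fun_pos[OF assms(1) \<mu>_nondeg] assms(2,3)])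
  qed (use h_fun_holomorphic Im_h_fun_pos assms(1) \<mu>_nondeg \<nu> in auto)
  obtain Z where Z: "uncountable Z"
    "\<And>z. z \<in> Z \<Longrightarrow> 0 < Im z \<and> (\<exists>w. sub_point z w \<and> recip_F \<rho> z = recip_F \<mu> w)"
    unfolding sub_point_def iter_def using free_conv_subordinate[OF conv] by (metis (no_types, lifting))
  obtain z1 where "z1 \<in> Z" using Z(1) by (metis countable_empty equals0I)
  then obtain w1 where "0 \<le> Im z1" "sub_point z1 w1" using Z(2) less_imp_le by blast
  then obtain \<omega> where \<omega>: "\<And>z. 0 \<le> Im z \<Longrightarrow> sub_point z (\<omega> z)" and
    ext: "\<And>z0. 0 \<le> Im z0 \<Longrightarrow> \<exists>\<delta>>0. \<exists>W. W holomorphic_on ball z0 \<delta> \<and>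
       (\<forall>z\<in>ball z0 \<delta>. 0 < Im (W z) \<and> (0 \<le> Im z \<longrightarrow> \<omega> z = W z))"
    using subordination_function by metis
  \<comment> \<open>The candidate extension of \<open>cauchy_G \<rho>\<close> to the closed
    half-plane. It is defined at real points too, because \<open>\<omega>\<close> sends them into
    the open half-plane.\<close>
  define \<Gamma> where "\<Gamma> z = cauchy_G \<mu> (\<omega> z)" for z
  have ext\<Gamma>: "\<exists>\<delta>>0. \<exists>A. A holomorphic_on ball z0 \<delta> \<and> (\<forall>z\<in>ball z0 \<delta>. 0 \<le> Im z \<longrightarrow> \<Gamma> z = A z)"
    if z0: "0 \<le> Im z0" for z0
  proof -
    obtain \<delta> W where W: "\<delta> > 0" "W holomorphic_on ball z0 \<delta>"
       "\<And>z. z \<in> ball z0 \<delta> \<Longrightarrow> 0 < Im (W z) \<and> (0 \<le> Im z \<longrightarrow> \<omega> z = W z)"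
      using ext[OF z0] by blast
    have "(\<lambda>z. cauchy_G \<mu> (W z)) holomorphic_on ball z0 \<delta>"
      by (rule holomorphic_on_compose_gen[OF W(2) cauchy_G_holomorphic[OF assms(1)], unfolded o_def])
         (use W(3) in auto)
    then show ?thesis using W by (intro exI[of _ \<delta>] exI[of _ "\<lambda>z. cauchy_G \<mu> (W z)"] conjI) (auto simp: \<Gamma>_def)
  qed
  have cont: "continuous_on {z. 0 \<le> Im z} \<Gamma>"
    unfolding continuous_on_eq_continuous_within
  proof
    fix z0 assume "z0 \<in> {z. 0 \<le> Im z}"
    then have z0: "0 \<le> Im z0" by simp
    obtain \<delta> A where A: "\<delta> > 0" "A holomorphic_on ball z0 \<delta>"
        "\<And>z. z \<in> ball z0 \<delta> \<Longrightarrow> 0 \<le> Im z \<Longrightarrow> \<Gamma> z = A z"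
      using ext\<Gamma>[OF z0] by blast
    have "isCont A z0"
      using holomorphic_on_imp_continuous_on[OF A(2)] A(1) by (simp add: continuous_on_eq_continuous_at)
    then have "continuous (at z0 within {z. 0 \<le> Im z}) A" by (rule continuous_at_imp_continuous_at_within)
    then show "continuous (at z0 within {z. 0 \<le> Im z}) \<Gamma>"
      by (rule continuous_transform_within[OF _ A(1)]) (use A z0 in \<open>auto simp: dist_commute\<close>)
  qed
  have "\<Gamma> holomorphic_on uhp"
  proof (rule holomorphic_onI)
    fix z0 assume z0: "z0 \<in> uhp"
    then have "0 \<le> Im z0" by simp
    then obtain \<delta> A where A: "\<delta> > 0" "A holomorphic_on ball z0 \<delta>"
        "\<And>z. z \<in> ball z0 \<delta> \<Longrightarrow> 0 \<le> Im z \<Longrightarrow> \<Gamma> z = A z"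
      using ext\<Gamma> by blast
    have dA: "A field_differentiable at z0 within uhp"
      by (rule field_differentiable_at_within[OF holomorphic_on_imp_differentiable_at[OF A(2) open_ball]])
         (use A(1) in simp)
    show "\<Gamma> field_differentiable at z0 within uhp"
      by (rule field_differentiable_transform_within[OF A(1) z0 _ dA]) (use A in \<open>auto simp: dist_commute\<close>)
  qed
  \<comment> \<open>By uniqueness the fixed points found from the Voiculescu transforms are values
    of \<open>\<omega>\<close>, so \<open>\<Gamma>\<close> and \<open>cauchy_G \<rho>\<close> agree
    on the uncountable set \<open>Z\<close>.\<close>
  moreover have "Z \<subseteq> {z \<in> uhp. \<Gamma> z = cauchy_G \<rho> z}"
  proof
    fix z assume "z \<in> Z"
    then obtain w where w: "0 < Im z" "sub_point z w" "recip_F \<rho> z = recip_F \<mu> w" using Z(2) by blast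
    have "w = \<omega> z" using sub_point_unique[OF _ w(2) \<omega>] w(1) by simp
    with w(3) have "cauchy_G \<rho> z = \<Gamma> z" by (simp add: recip_F_def \<Gamma>_def)
    then show "z \<in> {z \<in> uhp. \<Gamma> z = cauchy_G \<rho> z}" using w by simp
  qed
  then have "uncountable {z \<in> uhp. \<Gamma> z = cauchy_G \<rho> z}" using Z(1) countable_subset by blast
  moreover have "connected uhp" by (intro convex_connected convex_halfspace_Im_gt)
  ultimately have "uhp \<subseteq> {z \<in> uhp. \<Gamma> z = cauchy_G \<rho> z}"
    using cauchy_G_holomorphic[OF \<rho>] fsigma_uhp
    by (intro holomorphic_countable_equal) (auto simp: open_halfspace_Im_gt)
  then have \<Gamma>\<rho>: "\<Gamma> z = cauchy_G \<rho> z" if "0 < Im z" for z using that by blast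
  define f where "f t = - Im (\<Gamma> (of_real t)) / pi" for t
  have dens: "\<rho> = density lborel (\<lambda>t. ennreal (f t))"
    unfolding f_def by (rule stieltjes_inversion[OF \<rho> cont \<Gamma>\<rho>])
  have pos: "f t > 0" for t
  proof -
    have "0 < Im (\<omega> (of_real t))" using \<omega>[of "of_real t"] by (simp add: sub_point_def)
    then have "Im (\<Gamma> (of_real t)) < 0" unfolding \<Gamma>_def by (rule Im_cauchy_G_neg[OF assms(1)])
    then show ?thesis by (simp add: f_def divide_neg_pos)
  qed
  have "real_analytic_on UNIV f"
  proof (rule real_analytic_Im[of _ "- 1 / pi"])
    fix x :: real
    obtain \<delta> A where A: "\<delta> > 0" "A holomorphic_on ball (of_real x) \<delta>"
        "\<And>z. z \<in> ball (of_real x) \<delta> \<Longrightarrow> 0 \<le> Im z \<Longrightarrow> \<Gamma> z = A z"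
      using ext\<Gamma>[of "of_real x"] by auto
    have "f t = - 1 / pi * Im (A (of_real t))" if "\<bar>t - x\<bar> < \<delta>" for t
    proof -
      have "dist (complex_of_real x) (of_real t) = \<bar>t - x\<bar>"
        by (simp add: dist_norm norm_minus_commute flip: of_real_diff)
      then show ?thesis using A(3)[of "of_real t"] that by (simp add: f_def)
    qed
    then show "\<exists>\<delta>>0. \<exists>A. A holomorphic_on ball (of_real x) \<delta> \<and>
      (\<forall>t. \<bar>t - x\<bar> < \<delta> \<longrightarrow> f t = - 1 / pi * Im (A (of_real t)))"
      using A by blast
  qed
  moreover have "(\<lambda>t. ennreal (f t)) \<in> borel_measurable lborel"
  proof -
    have "(\<lambda>t::real. \<Gamma> (of_real t)) \<in> borel_measurable borel"
      by (intro borel_measurable_continuous_onI continuous_on_compose2[OF cont]) (auto intro!: continuous_intros)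
    then show ?thesis unfolding f_def by measurable
  qed
  then have "absolutely_continuous lborel \<rho>"
    unfolding dens by (rule absolutely_continuousI_density)
  ultimately show "absolutely_continuous lborel \<rho> \<and>
           (\<exists>f::real \<Rightarrow> real. (\<forall>x. f x > 0) \<and> real_analytic_on UNIV f \<and>
               \<rho> = density lborel (\<lambda>x. ennreal (f x)))"
    using pos dens by blast
qed

end
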